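(* Let $\mathfrak g$ be a non-compact semisimple Lie algebra with Cartan decomposition $\mathfrak g=\mathfrak k\oplus\mathfrak s$ and Cartan involution $\theta$, let $\mathfrak a\subset\mathfrak s$ be maximal abelian with a choice of positive Weyl chamber $\mathfrak a^+$, and let $K$ be the connected subgroup of $\mathrm{Aut}_0\,\mathfrak g$ with Lie algebra $\mathfrak k$. For every $r>0$ and every $H\in\mathrm{cl}(\mathfrak a^+)$, $$\mathrm{Ad}_r(G)\cdot H=\bigcup_{k\in K}\Big(\mathrm{Ad}(k)(H)+\psi_r\big(\mathrm{Ad}(k)(\mathfrak n_H^+)\big)\Big).$$
   Context: For $r>0$ let $T_r:\mathfrak g\to\mathfrak g$ be the linear map with $T_r(X)=rX$ for $X\in\mathfrak k$ and $T_r(Y)=Y$ for $Y\in\mathfrak s$, and let $\mathfrak g_r$ be the vector space $\mathfrak g$ with the Lie bracket $[X,Y]_r=T_r[T_r^{-1}X,T_r^{-1}Y]$. Then $\mathfrak g_r$ is a semisimple Lie algebra isomorphic to $\mathfrak g$. Let $G_r=\mathrm{Aut}_0\,\mathfrak g_r$ be the identity component of the automorphism group of $\mathfrak g_r$ (so $G=G_1=\mathrm{Aut}_0\,\mathfrak g$). $\mathrm{Ad}_r(G)\cdot H$ denotes the adjoint orbit of $H$ in $\mathfrak g_r$, i.e. the orbit of $H$ under $G_r$, viewed as a subset of the vector space $\mathfrak g$. The map $\psi_r:\mathfrak g\to\mathfrak g$ is $\psi_r(Z)=Z+\frac{r-1}{r+1}\theta Z$. With $\Pi$ the set of roots of $\mathfrak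 a$ and $\mathfrak g_\alpha$ ($\alpha\in\Pi$) the root spaces in $\mathfrak g$, $\mathfrak n_H^+=\sum_{\alpha(H)>0}\mathfrak g_\alpha$. $\mathrm{Ad}$ is the usual adjoint action on $\mathfrak g$, and $\mathrm{cl}$ denotes closure. A complex $\mathfrak g$ is treated as a real Lie algebra. *)

theory Defs
  imports "HOL-Analysis.Analysis"
begin

text \<open>
  A real Lie algebra is a bracket on a type of class \<^class>\<open>euclidean_space\<close>. The class only
  supplies a nonzero finite-dimensional real vector space with its usual topology; its inner
  product is auxiliary and unrelated to the bracket.
\<close>

definition lie_bracket :: "('a::euclidean_space \<Rightarrow> 'a \<Rightarrow> 'a) \<Rightarrow> bool" where
  "lie_bracket br \<longleftrightarrow> bilinear br \<and> (\<forall>X. br X X = 0) \<and>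
     (\<forall>X Y Z. br X (br Y Z) + br Y (br Z X) + br Z (br X Y) = 0)"

definition ad :: "('a::euclidean_space \<Rightarrow> 'a \<Rightarrow> 'a) \<Rightarrow> 'a \<Rightarrow> 'a \<Rightarrow>\<^sub>L 'a" where
  "ad br X = Blinfun (br X)"

subsection \<open>Semisimplicity and the Killing form\<close>

definition lie_ideal :: "('a::euclidean_space \<Rightarrow> 'a \<Rightarrow> 'a) \<Rightarrow> 'a set \<Rightarrow> bool" where
  "lie_ideal br I \<longleftrightarrow> subspace I \<and> (\<forall>X. \<forall>Y\<in>I. br X Y \<in> I)"

definition derived_algebra :: "('a::euclidean_space \<Rightarrow> 'a \<Rightarrow> 'a) \<Rightarrow> 'a set \<Rightarrow> 'a set" where
  "derived_algebra br S = span {br X Y | X Y. X \<in> S \<and> Y \<in> S}"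

definition lie_solvable :: "('a::euclidean_space \<Rightarrow> 'a \<Rightarrow> 'a) \<Rightarrow> 'a set \<Rightarrow> bool" where
  "lie_solvable br S \<longleftrightarrow> (\<exists>n. (derived_algebra br ^^ n) S = {0})"

definition semisimple :: "('a::euclidean_space \<Rightarrow> 'a \<Rightarrow> 'a) \<Rightarrow> bool" where
  "semisimple br \<longleftrightarrow> (\<forall>I. lie_ideal br I \<and> lie_solvable br I \<longrightarrow> I = {0})"

text \<open>The trace of a linear map does not depend on the basis used to compute it.\<close>

definition lin_trace :: "('a::euclidean_space \<Rightarrow> 'a) \<Rightarrow> real" where
  "lin_trace f = (\<Sum>b\<in>Basis. f b \<bullet> b)"

definition killing :: "('a::euclidean_space \<Rightarrow> 'a \<Rightarrow> 'a) \<Rightarrow> 'a \<Rightarrow> 'a \<Rightarrow> real" where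
  "killing br X Y = lin_trace (br X \<circ> br Y)"

text \<open>A semisimple Lie algebra is compact when its Killing form is negative definite. Hence
  \<open>noncompact\<close> does not exclude compact simple factors.\<close>

definition noncompact :: "('a::euclidean_space \<Rightarrow> 'a \<Rightarrow> 'a) \<Rightarrow> bool" where
  "noncompact br \<longleftrightarrow> \<not> (\<forall>X. X \<noteq> 0 \<longrightarrow> killing br X X < 0)"

subsection \<open>Cartan decomposition, roots and Weyl chambers\<close>

definition cartan_involution ::
    "('a::euclidean_space \<Rightarrow> 'a \<Rightarrow> 'a) \<Rightarrow> ('a \<Rightarrow> 'a) \<Rightarrow> bool" where
  "cartan_involution br \<theta> \<longleftrightarrow> linear \<theta> \<and> (\<forall>X. \<theta> (\<theta> X) = X) \<and>
     (\<forall>X Y. \<theta> (br X Y) = br (\<theta> X) (\<theta> Y)) \<and>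
     (\<forall>X. X \<noteq> 0 \<longrightarrow> - killing br X (\<theta> X) > 0)"

definition cartan_decomposition ::
    "('a::euclidean_space \<Rightarrow> 'a \<Rightarrow> 'a) \<Rightarrow> ('a \<Rightarrow> 'a) \<Rightarrow> 'a set \<Rightarrow> 'a set \<Rightarrow> bool" where
  "cartan_decomposition br \<theta> \<kk> \<ss> \<longleftrightarrow> cartan_involution br \<theta> \<and>
     \<kk> = {X. \<theta> X = X} \<and> \<ss> = {X. \<theta> X = - X}"

definition abelian_subspace :: "('a::euclidean_space \<Rightarrow> 'a \<Rightarrow> 'a) \<Rightarrow> 'a set \<Rightarrow> bool" where
  "abelian_subspace br \<aa> \<longleftrightarrow> subspace \<aa> \<and> (\<forall>X\<in>\<aa>. \<forall>Y\<in>\<aa>. br X Y = 0)"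

definition maximal_abelian_in ::
    "('a::euclidean_space \<Rightarrow> 'a \<Rightarrow> 'a) \<Rightarrow> 'a set \<Rightarrow> 'a set \<Rightarrow> bool" where
  "maximal_abelian_in br \<ss> \<aa> \<longleftrightarrow> abelian_subspace br \<aa> \<and> \<aa> \<subseteq> \<ss> \<and>
     (\<forall>\<bb>. abelian_subspace br \<bb> \<and> \<aa> \<subseteq> \<bb> \<and> \<bb> \<subseteq> \<ss> \<longrightarrow> \<bb> = \<aa>)"

definition root_space ::
    "('a::euclidean_space \<Rightarrow> 'a \<Rightarrow> 'a) \<Rightarrow> 'a set \<Rightarrow> ('a \<Rightarrow> real) \<Rightarrow> 'a set" where
  "root_space br \<aa> \<alpha> = {X. \<forall>H\<in>\<aa>. br H X = \<alpha> H *\<^sub>R X}"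

text \<open>A linear functional on the subspace \<open>\<aa>\<close> is encoded as a function that is extensional
  on \<open>\<aa>\<close>, so that each root is represented by exactly one function.\<close>

definition dual_of :: "'a::euclidean_space set \<Rightarrow> ('a \<Rightarrow> real) set" where
  "dual_of \<aa> = {\<alpha> \<in> extensional \<aa>.
     (\<forall>X\<in>\<aa>. \<forall>Y\<in>\<aa>. \<alpha> (X + Y) = \<alpha> X + \<alpha> Y) \<and> (\<forall>c. \<forall>X\<in>\<aa>. \<alpha> (c *\<^sub>R X) = c * \<alpha> X)}"

definition roots :: "('a::euclidean_space \<Rightarrow> 'a \<Rightarrow> 'a) \<Rightarrow> 'a set \<Rightarrow> ('a \<Rightarrow> real) set" where
  "roots br \<aa> = {\<alpha> \<in> dual_of \<aa>. (\<exists>H\<in>\<aa>. \<alpha> H \<noteq> 0) \<and> root_space br \<aa> \<alpha> \<noteq> {0}}"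

definition weyl_chamber ::
    "('a::euclidean_space \<Rightarrow> 'a \<Rightarrow> 'a) \<Rightarrow> 'a set \<Rightarrow> 'a set \<Rightarrow> bool" where
  "weyl_chamber br \<aa> C \<longleftrightarrow> C \<in> components {H \<in> \<aa>. \<forall>\<alpha>\<in>roots br \<aa>. \<alpha> H \<noteq> 0}"

text \<open>The sum of a family of subspaces is the span of their union.\<close>

definition n_plus :: "('a::euclidean_space \<Rightarrow> 'a \<Rightarrow> 'a) \<Rightarrow> 'a set \<Rightarrow> 'a \<Rightarrow> 'a set" where
  "n_plus br \<aa> H = span (\<Union>\<alpha>\<in>{\<alpha> \<in> roots br \<aa>. \<alpha> H > 0}. root_space br \<aa> \<alpha>)"

subsection \<open>The automorphism group and its subgroups\<close>

definition lie_aut :: "('a::euclidean_space \<Rightarrow> 'a \<Rightarrow> 'a) \<Rightarrow> ('a \<Rightarrow>\<^sub>L 'a) set" where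
  "lie_aut br = {g. bij (blinfun_apply g) \<and>
     (\<forall>X Y. blinfun_apply g (br X Y) = br (blinfun_apply g X) (blinfun_apply g Y))}"

definition lie_aut0 :: "('a::euclidean_space \<Rightarrow> 'a \<Rightarrow> 'a) \<Rightarrow> ('a \<Rightarrow>\<^sub>L 'a) set" where
  "lie_aut0 br = connected_component_set (lie_aut br) id_blinfun"

text \<open>The Lie algebra of the automorphism group of a semisimple Lie algebra is identified with
  that Lie algebra through \<^const>\<open>ad\<close>. Since \<open>g \<circ> ad X \<circ> inv g = ad (g X)\<close>, the adjoint action of
  an automorphism \<open>g\<close> is then just evaluation of \<open>g\<close>.\<close>

definition adjoint_orbit :: "('a::euclidean_space \<Rightarrow> 'a \<Rightarrow> 'a) \<Rightarrow> 'a \<Rightarrow> 'a set" where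
  "adjoint_orbit br H = {blinfun_apply g H | g. g \<in> lie_aut0 br}"

definition blinfun_exp :: "('a::euclidean_space \<Rightarrow>\<^sub>L 'a) \<Rightarrow> 'a \<Rightarrow>\<^sub>L 'a" where
  "blinfun_exp D = (\<Sum>n. (1 / fact n) *\<^sub>R ((\<lambda>B. D o\<^sub>L B) ^^ n) id_blinfun)"

definition linear_subgroup :: "('a::euclidean_space \<Rightarrow>\<^sub>L 'a) set \<Rightarrow> bool" where
  "linear_subgroup K \<longleftrightarrow> id_blinfun \<in> K \<and> (\<forall>g\<in>K. \<forall>h\<in>K. g o\<^sub>L h \<in> K) \<and>
     (\<forall>g\<in>K. \<exists>h\<in>K. g o\<^sub>L h = id_blinfun \<and> h o\<^sub>L g = id_blinfun)"

definition lie_algebra_of :: "('a::euclidean_space \<Rightarrow>\<^sub>L 'a) set \<Rightarrow> ('a \<Rightarrow>\<^sub>L 'a) set" where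
  "lie_algebra_of K = {D. \<forall>t::real. blinfun_exp (t *\<^sub>R D) \<in> K}"

text \<open>
  For a general subalgebra \<open>\<hh>\<close> the analytic subgroup need not be the only set satisfying the
  following predicate, because \<open>connected\<close> refers to the subspace topology. For the fixed
  subalgebra \<open>\<kk>\<close> of a Cartan involution it is: such a \<open>K\<close> contains the analytic subgroup
  of \<open>\<kk>\<close> and normalizes \<open>\<kk>\<close>, and that analytic subgroup is the whole normalizer
  of \<open>\<kk>\<close> in the identity component (and is compact).
\<close>

definition connected_subgroup_with_lie_algebra ::
    "('a::euclidean_space \<Rightarrow> 'a \<Rightarrow> 'a) \<Rightarrow> 'a set \<Rightarrow> ('a \<Rightarrow>\<^sub>L 'a) set \<Rightarrow> bool" where
  "connected_subgroup_with_lie_algebra br \<hh> K \<longleftrightarrow> K \<subseteq> lie_aut0 br \<and>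
     linear_subgroup K \<and> connected K \<and> lie_algebra_of K = ad br ` \<hh>"

subsection \<open>The deformed bracket\<close>

text \<open>The two summands use the projections \<open>(Z + \<theta> Z) / 2\<close> and \<open>(Z - \<theta> Z) / 2\<close> onto the two
  eigenspaces of \<open>\<theta>\<close>.\<close>

definition T_map :: "('a::euclidean_space \<Rightarrow> 'a) \<Rightarrow> real \<Rightarrow> 'a \<Rightarrow> 'a" where
  "T_map \<theta> r Z = r *\<^sub>R ((1/2) *\<^sub>R (Z + \<theta> Z)) + (1/2) *\<^sub>R (Z - \<theta> Z)"

definition deformed_bracket ::
    "('a::euclidean_space \<Rightarrow> 'a \<Rightarrow> 'a) \<Rightarrow> ('a \<Rightarrow> 'a) \<Rightarrow> real \<Rightarrow> 'a \<Rightarrow> 'a \<Rightarrow> 'a" where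
  "deformed_bracket br \<theta> r X Y =
     T_map \<theta> r (br (inv (T_map \<theta> r) X) (inv (T_map \<theta> r) Y))"

definition psi :: "('a::euclidean_space \<Rightarrow> 'a) \<Rightarrow> real \<Rightarrow> 'a \<Rightarrow> 'a" where
  "psi \<theta> r Z = Z + ((r - 1) / (r + 1)) *\<^sub>R \<theta> Z"

lemma linear_T_map:
  assumes "linear \<theta>"
  shows "linear (T_map \<theta> r)"
  using assms
  by (intro linearI) (simp_all add: T_map_def linear_add linear_scale algebra_simps)

lemma T_map_fixed:
  assumes "\<theta> X = X"
  shows "T_map \<theta> r X = r *\<^sub>R X"
  using assms by (simp add: T_map_def flip: scaleR_2)

lemma T_map_antifixed:
  assumes "\<theta> Y = - Y"
  shows "T_map \<theta> r Y = Y"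
  using assms by (simp add: T_map_def flip: scaleR_2)

lemma T_map_unique:
  assumes \<theta>: "linear \<theta>" "\<And>X. \<theta> (\<theta> X) = X"
    and T: "linear T" "\<And>X. \<theta> X = X \<Longrightarrow> T X = r *\<^sub>R X" "\<And>Y. \<theta> Y = - Y \<Longrightarrow> T Y = Y"
  shows "T = T_map \<theta> r"
proof
  fix Z
  have Z: "Z = (1/2) *\<^sub>R (Z + \<theta> Z) + (1/2) *\<^sub>R (Z - \<theta> Z)"
    by (simp add: algebra_simps flip: scaleR_left.add)
  have "\<theta> ((1/2) *\<^sub>R (Z + \<theta> Z)) = (1/2) *\<^sub>R (Z + \<theta> Z)"
    and "\<theta> ((1/2) *\<^sub>R (Z - \<theta> Z)) = - ((1/2) *\<^sub>R (Z - \<theta> Z))"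
    using \<theta> by (simp_all add: linear_add linear_diff linear_scale algebra_simps)
  then have "T ((1/2) *\<^sub>R (Z + \<theta> Z)) = r *\<^sub>R ((1/2) *\<^sub>R (Z + \<theta> Z))"
    and "T ((1/2) *\<^sub>R (Z - \<theta> Z)) = (1/2) *\<^sub>R (Z - \<theta> Z)"
    using T(2,3) by blast+
  then show "T Z = T_map \<theta> r Z"
    unfolding T_map_def by (subst Z) (simp only: linear_add[OF T(1)])
qed

end

theory Submission
  imports Defs
begin

text \<open>
  Since \<open>T\<^sub>r\<close> conjugates \<open>Aut \<gg>\<close> to \<open>Aut \<gg>\<^sub>r\<close>, fixes \<open>H\<close>, commutes with \<open>K\<close> and
  equals \<open>(r + 1) / 2\<close> times \<open>\<psi>\<^sub>r\<close>, the claim reduces to \<open>G H = K (H + \<nn>)\<close> with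
  \<open>\<nn> = \<nn>\<^sub>H\<^sup>+\<close>. For \<open>H + \<nn> \<subseteq> G H\<close>, elements \<open>exp (ad X)\<close> with \<open>X \<in> \<nn>\<close> remove the
  \<open>\<nn>\<close>-part step by step. Conversely, the set of \<open>g \<in> G\<close> with \<open>g H \<in> K (H + \<nn>)\<close> is
  closed because \<open>K\<close> is compact, and open because \<open>\<gg> = \<kk> + \<pp>\<close>, where \<open>\<pp>\<close> is the parabolic
  subalgebra of \<open>H\<close>, so that automorphisms near the identity factor as \<open>exp (ad U) exp (ad P)\<close>
  with \<open>U \<in> \<kk>\<close> and \<open>P \<in> \<pp>\<close>; as \<open>G\<close> is connected, it is all of \<open>G\<close>. The local
  factorization and the fact that \<open>K\<close> is open in the centralizer of \<open>\<theta>\<close> both come from a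
  quantitative version of the theorem that all derivations of \<open>\<gg>\<close> are inner.
\<close>

section \<open>The exponential of an endomorphism\<close>

text \<open>\<open>G\<close> is given only as a connected component of a set of linear maps, and
  \<open>K\<close> only as a connected subgroup with prescribed one-parameter subgroups, so no
  manifold structure is at hand. Exponential coordinates that are onto near the identity take its
  place: an automorphism \<open>1 + E\<close> differs from some \<open>1 + ad Z\<close> by at most a
  constant times the square of the norm of \<open>E\<close>, and so small an error can always be
  reduced further, hence vanishes at a minimiser. The coordinates carry a free linear map
  \<open>\<kappa>\<close>: it is the identity when \<open>K\<close> is shown to be closed, and a
  linear choice of \<open>\<kk>\<close>-component modulo \<open>\<pp>\<close> in the openness
  argument. All nondegeneracy comes from the positivity of
  \<open>- killing br X (\<theta> X)\<close>.\<close>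

text \<open>Bounded endomorphisms do not form an instance of the normed algebra classes, because
  \<open>'a \<Rightarrow>\<^sub>L 'b\<close> has two type arguments. The copy \<open>endo\<close> gives access to the library
  function \<^const>\<open>exp\<close>.\<close>

typedef (overloaded) 'a endo = "UNIV :: ('a::euclidean_space \<Rightarrow>\<^sub>L 'a) set"
  morphisms of_endo Endo ..

setup_lifting type_definition_endo

instantiation endo :: (euclidean_space) real_normed_algebra_1
begin

lift_definition zero_endo :: "'a endo" is 0 .
lift_definition one_endo :: "'a endo" is id_blinfun .
lift_definition plus_endo :: "'a endo \<Rightarrow> 'a endo \<Rightarrow> 'a endo" is "(+)" .
lift_definition minus_endo :: "'a endo \<Rightarrow> 'a endo \<Rightarrow> 'a endo" is "(-)" .
lift_definition uminus_endo :: "'a endo \<Rightarrow> 'a endo" is uminus .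
lift_definition times_endo :: "'a endo \<Rightarrow> 'a endo \<Rightarrow> 'a endo" is "(o\<^sub>L)" .
lift_definition scaleR_endo :: "real \<Rightarrow> 'a endo \<Rightarrow> 'a endo" is "scaleR" .
lift_definition norm_endo :: "'a endo \<Rightarrow> real" is norm .

definition dist_endo :: "'a endo \<Rightarrow> 'a endo \<Rightarrow> real" where
  "dist_endo x y = norm (x - y)"
definition sgn_endo :: "'a endo \<Rightarrow> 'a endo" where
  "sgn_endo x = scaleR (inverse (norm x)) x"
definition uniformity_endo :: "('a endo \<times> 'a endo) filter" where
  "uniformity_endo = (INF e\<in>{0 <..}. principal {(x, y). dist x y < e})"
definition open_endo :: "'a endo set \<Rightarrow> bool" where
  "open_endo U = (\<forall>x\<in>U. \<forall>\<^sub>F (x', y) in uniformity. x' = x \<longrightarrow> y \<in> U)"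

instance
proof
  fix x y z :: "'a endo" and a b :: real
  show "(0::'a endo) \<noteq> 1"
    by transfer (metis norm_blinfun_id norm_zero zero_neq_one)
  show "norm (x + y) \<le> norm x + norm y" by transfer (rule norm_triangle_ineq)
  show "norm (x * y) \<le> norm x * norm y" by transfer (rule norm_blinfun_compose)
  show "norm (1::'a endo) = 1" by transfer simp
qed ((simp add: dist_endo_def sgn_endo_def uniformity_endo_def open_endo_def; fail) |
  (transfer; simp add: algebra_simps scaleR_add_left blinfun_eqI blinfun.bilinear_simps; fail))+

end

lemma bounded_linear_of_endo: "bounded_linear of_endo"
  by (rule bounded_linear_intro[where K=1])
    (simp_all add: plus_endo.rep_eq scaleR_endo.rep_eq norm_endo.rep_eq)

lemma bounded_linear_Endo: "bounded_linear Endo"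
  by (rule bounded_linear_intro[where K=1])
    (simp_all add: plus_endo.abs_eq scaleR_endo.abs_eq norm_endo.abs_eq)

instance endo :: (euclidean_space) banach
proof
  fix X :: "nat \<Rightarrow> 'a endo"
  assume "Cauchy X"
  then have "Cauchy (\<lambda>n. of_endo (X n))"
    using bounded_linear.Cauchy[OF bounded_linear_of_endo] by blast
  then obtain L where "(\<lambda>n. of_endo (X n)) \<longlonglongrightarrow> L"
    by (auto simp: Cauchy_convergent_iff convergent_def)
  from bounded_linear.tendsto[OF bounded_linear_Endo this] show "convergent X"
    by (auto simp: convergent_def of_endo_inverse)
qed

lemma of_endo_power: "of_endo (x ^ n) = ((\<lambda>B. of_endo x o\<^sub>L B) ^^ n) id_blinfun"
  by (induction n) (simp_all add: one_endo.rep_eq times_endo.rep_eq)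

lemma blinfun_exp_conv_endo: "blinfun_exp D = of_endo (exp (Endo D))"
proof -
  have "(\<lambda>n. of_endo (Endo D ^ n /\<^sub>R fact n)) sums of_endo (exp (Endo D))"
    by (intro bounded_linear.sums[OF bounded_linear_of_endo] exp_converges)
  then have "(\<lambda>n. (1 / fact n) *\<^sub>R ((\<lambda>B. D o\<^sub>L B) ^^ n) id_blinfun) sums of_endo (exp (Endo D))"
    by (simp add: scaleR_endo.rep_eq of_endo_power Endo_inverse inverse_eq_divide)
  then show ?thesis
    by (simp add: blinfun_exp_def sums_iff)
qed

lemma blinfun_exp_0: "blinfun_exp 0 = id_blinfun"
  by (simp add: blinfun_exp_conv_endo zero_endo.abs_eq[symmetric] one_endo.rep_eq)

lemma blinfun_exp_inverse:
  "blinfun_exp D o\<^sub>L blinfun_exp (- D) = id_blinfun"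
  "blinfun_exp (- D) o\<^sub>L blinfun_exp D = id_blinfun"
  using exp_minus_inverse[of "Endo D"] exp_minus_inverse[of "- Endo D"]
  by (simp_all add: blinfun_exp_conv_endo uminus_endo.abs_eq
      flip: times_endo.rep_eq one_endo.rep_eq)

lemma blinfun_exp_sums:
  "(\<lambda>n. (1 / fact n) *\<^sub>R (blinfun_apply D ^^ n) z) sums blinfun_exp D z"
proof -
  have pow: "blinfun_apply (of_endo (Endo D ^ n)) z = (blinfun_apply D ^^ n) z" for n
    by (induction n arbitrary: z)
      (simp_all add: one_endo.rep_eq times_endo.rep_eq Endo_inverse)
  have "(\<lambda>n. of_endo (Endo D ^ n /\<^sub>R fact n) z) sums of_endo (exp (Endo D)) z"
    by (intro bounded_linear.sums[OF bounded_linear_compose[OF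
          blinfun.bounded_linear_left bounded_linear_of_endo]] exp_converges)
  then show ?thesis
    by (simp add: scaleR_endo.rep_eq blinfun.scaleR_left pow inverse_eq_divide
        blinfun_exp_conv_endo)
qed

lemma blinfun_exp_commute: "blinfun_exp (t *\<^sub>R D) o\<^sub>L D = D o\<^sub>L blinfun_exp (t *\<^sub>R D)"
  using arg_cong[OF exp_times_scaleR_commute[of t "Endo D"], of of_endo]
  by (simp add: blinfun_exp_conv_endo scaleR_endo.abs_eq times_endo.rep_eq Endo_inverse)

lemma has_vector_derivative_blinfun_exp:
  "((\<lambda>t. blinfun_exp (t *\<^sub>R D)) has_vector_derivative (blinfun_exp (t *\<^sub>R D) o\<^sub>L D))
     (at t within T)"
proof -
  have "((\<lambda>t. exp (t *\<^sub>R Endo D)) has_vector_derivative exp (t *\<^sub>R Endo D) * Endo D) (at t within T)"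
    by (rule exp_scaleR_has_vector_derivative_right)
  from bounded_linear.has_vector_derivative[OF bounded_linear_of_endo this] show ?thesis
    by (simp add: blinfun_exp_conv_endo scaleR_endo.abs_eq times_endo.rep_eq Endo_inverse)
qed

lemma sums_mem_subspace:
  fixes V :: "'a::euclidean_space set"
  assumes "subspace V" "f sums s" "\<And>n. f n \<in> V"
  shows "s \<in> V"
  using closed_sequentially[OF closed_subspace[OF assms(1)], of "\<lambda>n. \<Sum>i<n. f i" s] assms
  by (auto simp: sums_def intro: subspace_sum)

text \<open>If \<open>D\<close> maps \<open>z\<close> into the invariant subspace \<open>V\<close>, then all terms of the exponential
  series except the first lie in \<open>V\<close>; likewise with one more term.\<close>

lemma blinfun_exp_minus_id_mem:
  assumes V: "subspace V" "\<And>v. v \<in> V \<Longrightarrow> blinfun_apply D v \<in> V" and z: "D z \<in> V"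
  shows "blinfun_exp D z - z \<in> V"
proof -
  have "(\<lambda>n. (1 / fact (n + 1)) *\<^sub>R (blinfun_apply D ^^ (n + 1)) z) sums (blinfun_exp D z - z)"
    using sums_split_initial_segment[OF blinfun_exp_sums[of D z], of 1] by simp
  moreover have "(blinfun_apply D ^^ (n + 1)) z \<in> V" for n
    by (induction n) (use V z in auto)
  ultimately show ?thesis
    using sums_mem_subspace[OF V(1)] subspace_scale[OF V(1)] by blast
qed

lemma blinfun_exp_minus_linear_mem:
  assumes V: "subspace V" "\<And>v. v \<in> V \<Longrightarrow> blinfun_apply D v \<in> V" and z: "D (D z) \<in> V"
  shows "blinfun_exp D z - z - D z \<in> V"
proof -
  have "(\<lambda>n. (1 / fact (n + 2)) *\<^sub>R (blinfun_apply D ^^ (n + 2)) z) sums (blinfun_exp D z - z - D z)"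
    using sums_split_initial_segment[OF blinfun_exp_sums[of D z], of 2]
    by (simp add: numeral_2_eq_2 algebra_simps)
  moreover have "(blinfun_apply D ^^ (n + 2)) z \<in> V" for n
    by (induction n) (use V z in auto)
  ultimately show ?thesis
    using sums_mem_subspace[OF V(1)] subspace_scale[OF V(1)] by blast
qed

lemma blinfun_exp_conjugate:
  assumes "g o\<^sub>L h = id_blinfun" "h o\<^sub>L g = id_blinfun"
  shows "g o\<^sub>L blinfun_exp D o\<^sub>L h = blinfun_exp (g o\<^sub>L D o\<^sub>L h)"
proof -
  have hg: "blinfun_apply h (blinfun_apply g z) = z" for z
    using arg_cong[OF assms(2), of "\<lambda>f. blinfun_apply f z"] by simp
  have gh: "blinfun_apply g (blinfun_apply h z) = z" for z
    using arg_cong[OF assms(1), of "\<lambda>f. blinfun_apply f z"] by simp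
  have pow: "(blinfun_apply (g o\<^sub>L D o\<^sub>L h) ^^ n) z = g ((blinfun_apply D ^^ n) (h z))" for n z
    by (induction n) (simp_all add: hg gh)
  have "(\<lambda>n. g ((1 / fact n) *\<^sub>R (blinfun_apply D ^^ n) (h z))) sums g (blinfun_exp D (h z))" for z
    by (intro bounded_linear.sums[OF blinfun.bounded_linear_right] blinfun_exp_sums)
  then have "g (blinfun_exp D (h z)) = blinfun_exp (g o\<^sub>L D o\<^sub>L h) z" for z
    using blinfun_exp_sums[of "g o\<^sub>L D o\<^sub>L h" z]
    by (simp only: pow blinfun.scaleR_right) (rule sums_unique2)
  then show ?thesis
    by (intro blinfun_eqI) simp
qed

section \<open>Estimates for the exponential in a Banach algebra\<close>

text \<open>The factors need not commute, so they are exchanged one at a time; each of the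
  \<open>n + 1\<close> exchanges costs \<open>\<rho> ^ n * norm (x - y)\<close>.\<close>

lemma norm_power_diff_le:
  fixes x y :: "'a::real_normed_algebra_1"
  assumes "norm x \<le> \<rho>" "norm y \<le> \<rho>"
  shows "norm (x ^ Suc n - y ^ Suc n) \<le> real (Suc n) * \<rho> ^ n * norm (x - y)"
proof (induction n)
  case (Suc n)
  have \<rho>: "0 \<le> \<rho>" using assms(1) norm_ge_zero order_trans by blast
  have "x ^ Suc (Suc n) - y ^ Suc (Suc n) = x * (x ^ Suc n - y ^ Suc n) + (x - y) * y ^ Suc n"
    by (simp add: algebra_simps)
  also have "norm \<dots> \<le> \<rho> * (real (Suc n) * \<rho> ^ n * norm (x - y)) + norm (x - y) * \<rho> ^ Suc n"
    by (intro norm_triangle_le add_mono order_trans[OF norm_mult_ineq] mult_mono assms Suc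
        order_trans[OF norm_power_ineq] power_mono)
      (use \<rho> in \<open>auto intro!: mult_nonneg_nonneg\<close>)
  finally show ?case by (simp add: algebra_simps)
qed simp

lemma fact_Suc_ge_power2: "(2::real) ^ n \<le> fact (Suc n)"
proof (induction n)
  case (Suc n)
  have "2 * (2::real) ^ n \<le> real (Suc (Suc n)) * fact (Suc n)"
    by (intro mult_mono Suc) auto
  then show ?case by (simp only: power_Suc fact_Suc[of "Suc n"] of_nat_mult of_nat_fact)
qed simp

text \<open>The terms of degree 0 and 1 cancel. In the others the factorial absorbs the factor
  \<open>n + 2\<close> of the power estimate and still leaves \<open>fact (n + 1)\<close>, so a
  geometric series with sum 2 dominates.\<close>

lemma norm_exp_diff_minus_diff_le:
  fixes x y :: "'a::{real_normed_algebra_1,banach}"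
  assumes "norm x \<le> \<rho>" "norm y \<le> \<rho>" "\<rho> \<le> 1"
  shows "norm (exp x - exp y - (x - y)) \<le> 2 * \<rho> * norm (x - y)"
proof -
  have \<rho>: "0 \<le> \<rho>" using assms(1) norm_ge_zero order_trans by blast
  let ?f = "\<lambda>n. (x ^ n - y ^ n) /\<^sub>R fact n"
  have "?f sums (exp x - exp y)"
    using sums_diff[OF exp_converges[of x] exp_converges[of y]] by (simp add: scaleR_diff_right)
  from sums_split_initial_segment[OF this, of 2]
  have s: "(\<lambda>n. ?f (n + 2)) sums (exp x - exp y - (x - y))"
    by (simp add: numeral_2_eq_2)
  have bound: "norm (?f (n + 2)) \<le> \<rho> * norm (x - y) * (1/2) ^ n" for n
  proof -
    have "norm (x ^ (n + 2) - y ^ (n + 2)) \<le> real (n + 2) * \<rho> ^ Suc n * norm (x - y)"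
      using norm_power_diff_le[OF assms(1,2), of "Suc n"] by simp
    also have "\<dots> \<le> real (n + 2) * \<rho> * norm (x - y)"
      using \<rho> assms(3) by (intro mult_mono) (auto simp: mult_left_le power_le_one)
    finally have "norm (?f (n + 2)) \<le> (real (n + 2) * \<rho> * norm (x - y)) / fact (n + 2)"
      by (simp add: divide_inverse mult.commute mult_left_mono del: fact_Suc)
    also have "\<dots> = \<rho> * norm (x - y) / fact (Suc n)"
      by (simp add: divide_simps)
    also have "\<dots> \<le> \<rho> * norm (x - y) / 2 ^ n"
      using \<rho> fact_Suc_ge_power2[of n] by (intro divide_left_mono) auto
    finally show ?thesis by (simp add: power_divide)
  qed
  have g: "(\<lambda>n. \<rho> * norm (x - y) * (1/2) ^ n) sums (\<rho> * norm (x - y) * 2)"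
    using sums_mult[OF geometric_sums[of "1/2::real"], of "\<rho> * norm (x - y)"] by simp
  have "norm (\<Sum>n. ?f (n + 2)) \<le> (\<Sum>n. \<rho> * norm (x - y) * (1/2) ^ n)"
    by (rule norm_suminf_le[OF bound sums_summable[OF g]])
  then show ?thesis
    unfolding sums_unique[OF s, symmetric] sums_unique[OF g, symmetric] by (simp add: mult.commute mult.left_commute)
qed

text \<open>Linearization near the identity, exchanging one exponential at a time. The remaining
  factors stay within \<open>7 * \<rho>\<close> of 1 (\<open>7 = 2 * 3 + 1\<close>), and
  exponentials differ by at most three times the difference of the exponents, which gives
  \<open>23 = 3 * 7 + 2\<close>.\<close>

lemma norm_exp_product_diff_le:
  fixes g :: "'a::{real_normed_algebra_1,banach}"
  assumes \<rho>: "\<rho> \<le> 1" "norm x1 \<le> \<rho>" "norm y1 \<le> \<rho>" "norm x2 \<le> \<rho>" "norm y2 \<le> \<rho>"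
    and g: "norm (g - 1) \<le> \<rho>"
  shows "norm (exp x1 * g * exp x2 - exp y1 * g * exp y2 - (x1 - y1) - (x2 - y2))
     \<le> 23 * \<rho> * (norm (x1 - y1) + norm (x2 - y2))"
proof -
  have \<rho>0: "0 \<le> \<rho>" using g norm_ge_zero order_trans by blast
  have diff: "norm (exp x - exp y) \<le> 3 * norm (x - y)" if "norm x \<le> \<rho>" "norm y \<le> \<rho>" for x y :: 'a
  proof -
    have "norm (exp x - exp y) \<le> norm (exp x - exp y - (x - y)) + norm (x - y)"
      using norm_triangle_ineq[of "exp x - exp y - (x - y)" "x - y"] by simp
    also have "\<dots> \<le> 2 * \<rho> * norm (x - y) + norm (x - y)"
      using norm_exp_diff_minus_diff_le[OF that \<rho>(1)] by simp
    also have "\<dots> \<le> 2 * 1 * norm (x - y) + norm (x - y)"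
      using \<rho>(1) \<rho>0 by (intro add_mono mult_mono) auto
    finally show ?thesis by simp
  qed
  have near: "norm (exp x - 1) \<le> 3 * \<rho>" if "norm x \<le> \<rho>" for x :: 'a
    using diff[OF that, of 0] that \<rho>0 by simp
  have g2: "norm g \<le> 2"
    using norm_triangle_ineq[of "g - 1" 1] g \<rho>(1) by simp
  define q where "q = g * exp x2"
  define p where "p = exp y1 * g"
  have "q - 1 = g * (exp x2 - 1) + (g - 1)" "p - 1 = (exp y1 - 1) * g + (g - 1)"
    by (simp_all add: q_def p_def algebra_simps)
  then have q: "norm (q - 1) \<le> 7 * \<rho>" and p: "norm (p - 1) \<le> 7 * \<rho>"
  proof -
    have "norm (g * (exp x2 - 1)) \<le> 2 * (3 * \<rho>)" "norm ((exp y1 - 1) * g) \<le> (3 * \<rho>) * 2"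
      by (intro order_trans[OF norm_mult_ineq] mult_mono g2 near \<rho>; use \<rho>0 in simp)+
    then show "norm (q - 1) \<le> 7 * \<rho>" "norm (p - 1) \<le> 7 * \<rho>"
      unfolding \<open>q - 1 = _\<close> \<open>p - 1 = _\<close>
      using g norm_triangle_ineq[of "g * (exp x2 - 1)" "g - 1"]
        norm_triangle_ineq[of "(exp y1 - 1) * g" "g - 1"] by linarith+
  qed
  have "exp x1 * g * exp x2 - exp y1 * g * exp y2 - (x1 - y1) - (x2 - y2) =
      ((exp x1 - exp y1) * (q - 1) + (exp x1 - exp y1 - (x1 - y1))) +
      ((p - 1) * (exp x2 - exp y2) + (exp x2 - exp y2 - (x2 - y2)))"
    by (simp add: q_def p_def algebra_simps)
  also have "norm \<dots> \<le> (3 * norm (x1 - y1) * (7 * \<rho>) + 2 * \<rho> * norm (x1 - y1)) +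
      (7 * \<rho> * (3 * norm (x2 - y2)) + 2 * \<rho> * norm (x2 - y2))"
    by (intro norm_triangle_le add_mono order_trans[OF norm_mult_ineq] mult_mono diff q p
        norm_exp_diff_minus_diff_le \<rho>) (use \<rho>0 in auto)
  finally show ?thesis by (simp add: algebra_simps)
qed

text \<open>The minimiser \<open>X\<close> of the distance of
  \<open>exp (- B X) * g * exp (- (A X - B X))\<close> from \<open>1\<close> makes it vanish: by \<open>approx\<close> the error is
  \<open>A Z\<close> up to second order, and replacing \<open>X\<close> by \<open>X + Z\<close> would decrease it.\<close>

lemma local_product_chart:
  fixes A B :: "'a::euclidean_space \<Rightarrow> 'e::{real_normed_algebra_1,banach}"
  assumes A: "bounded_linear A" and B: "bounded_linear B"
    and m: "m > 0" "\<And>X. m * norm X \<le> norm (A X)"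
    and approx: "\<And>h. h \<in> G \<Longrightarrow> \<exists>Z. norm (h - 1 - A Z) \<le> C * (norm (h - 1))\<^sup>2"
    and closed: "\<And>g X. g \<in> G \<Longrightarrow> exp (- B X) * g * exp (- (A X - B X)) \<in> G"
    and \<delta>: "\<delta> > 0"
  shows "\<exists>\<epsilon>>0. \<forall>g\<in>G. norm (g - 1) < \<epsilon> \<longrightarrow>
    (\<exists>X. norm X \<le> \<delta> \<and> exp (- B X) * g * exp (- (A X - B X)) = 1)"
proof -
  have AB: "bounded_linear (\<lambda>X. A X - B X)"
    by (intro bounded_linear_sub A B)
  obtain M1 where M1: "M1 > 0" "\<And>X. norm (B X) \<le> norm X * M1"
    using bounded_linear.pos_bounded[OF B] by blast
  obtain M2 where M2: "M2 > 0" "\<And>X. norm (A X - B X) \<le> norm X * M2"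
    using bounded_linear.pos_bounded[OF AB] by blast
  define M where "M = max M1 M2"
  have M: "M > 0" "norm (B X) \<le> M * norm X" "norm (A X - B X) \<le> M * norm X" for X
  proof -
    have "norm X * M1 \<le> norm X * M" "norm X * M2 \<le> norm X * M"
      by (intro mult_left_mono; simp add: M_def)+
    then show "M > 0" "norm (B X) \<le> M * norm X" "norm (A X - B X) \<le> M * norm X"
      using M1(1) M1(2)[of X] M2(2)[of X] by (auto simp: M_def mult.commute)
  qed
  \<comment> \<open>\<open>368 = 8 * 46\<close> and \<open>46 = 2 * 23\<close>: both exponents vary
    by at most \<open>M\<close> times the variation of \<open>X\<close>, and the nonlinear error is
    to stay below \<open>m / 8\<close>.\<close>
  define \<rho> where "\<rho> = min 1 (m / (368 * M))"
  have \<rho>: "\<rho> > 0" "\<rho> \<le> 1" "46 * \<rho> * M \<le> m / 8"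
  proof -
    show "\<rho> > 0" "\<rho> \<le> 1" using m M by (auto simp: \<rho>_def)
    have "\<rho> \<le> m / (368 * M)" by (simp add: \<rho>_def)
    then show "46 * \<rho> * M \<le> m / 8" using M(1) by (simp add: field_simps)
  qed
  define r where "r = min \<delta> (\<rho> / M)"
  have r: "r > 0" "r \<le> \<delta>" "M * r \<le> \<rho>"
    using \<delta> \<rho>(1) M(1) mult_left_mono[of r "\<rho> / M" M] by (auto simp: r_def)
  \<comment> \<open>The three bounds keep \<open>g\<close> in the range of the product estimate, the
    minimiser away from the boundary of the ball, and the quadratic error of \<open>approx\<close>
    below a quarter of the norm of \<open>F X\<close>.\<close>
  define \<epsilon> where "\<epsilon> = min \<rho> (min (m * r / 8) (1 / (4 * (\<bar>C\<bar> + 1))))"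
  have \<epsilon>: "\<epsilon> > 0" "\<epsilon> \<le> \<rho>" "\<epsilon> \<le> m * r / 8" "\<bar>C\<bar> * \<epsilon> \<le> 1 / 4"
  proof -
    show "\<epsilon> > 0" "\<epsilon> \<le> \<rho>" "\<epsilon> \<le> m * r / 8" using m r \<rho> by (auto simp: \<epsilon>_def)
    have "\<epsilon> \<le> 1 / (4 * (\<bar>C\<bar> + 1))" by (simp add: \<epsilon>_def)
    then have "(\<bar>C\<bar> + 1) * \<epsilon> \<le> 1 / 4" by (simp add: field_simps)
    then show "\<bar>C\<bar> * \<epsilon> \<le> 1 / 4" using \<open>\<epsilon> > 0\<close> by (simp add: algebra_simps)
  qed
  have "\<exists>X. norm X \<le> \<delta> \<and> exp (- B X) * g * exp (- (A X - B X)) = 1"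
    if g: "g \<in> G" "norm (g - 1) < \<epsilon>" for g
  proof -
    define F where "F X = exp (- B X) * g * exp (- (A X - B X)) - 1" for X
    \<comment> \<open>The exponents \<open>B X\<close> and \<open>A X - B X\<close> add up to
      \<open>A X\<close>, so the linear part of \<open>F\<close> is \<open>- A\<close> whatever
      \<open>B\<close> is.\<close>
    have est: "norm (F Y - F X + A (Y - X)) \<le> m / 8 * norm (Y - X)"
      if "norm X \<le> r" "norm Y \<le> r" for X Y
    proof -
      have small: "norm (- B Z) \<le> \<rho>" "norm (- (A Z - B Z)) \<le> \<rho>" if "norm Z \<le> r" for Z
      proof -
        have "M * norm Z \<le> \<rho>" using that M(1) r(3) by (meson mult_left_mono order.trans less_imp_le)
        then show "norm (- B Z) \<le> \<rho>" "norm (- (A Z - B Z)) \<le> \<rho>"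
          using M(2,3)[of Z] by (auto simp: norm_minus_commute)
      qed
      have *: "B (Y - X) = B Y - B X" "A (Y - X) = A Y - A X"
        using bounded_linear.linear[OF A] bounded_linear.linear[OF B] by (auto simp: linear_diff)
      have "F Y - F X + A (Y - X) = exp (- B Y) * g * exp (- (A Y - B Y)) -
          exp (- B X) * g * exp (- (A X - B X)) - (- B Y - - B X) -
          (- (A Y - B Y) - - (A X - B X))"
        by (simp add: F_def *)
      also have "norm \<dots> \<le> 23 * \<rho> * (norm (- B Y - - B X) + norm (- (A Y - B Y) - - (A X - B X)))"
        using g \<epsilon> by (intro norm_exp_product_diff_le small that \<rho>) auto
      also have "norm (- B Y - - B X) = norm (B (Y - X))"
        by (simp add: * norm_minus_commute)
      also have "norm (- (A Y - B Y) - - (A X - B X)) = norm (A (Y - X) - B (Y - X))"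
        unfolding * by (subst norm_minus_cancel[symmetric]) (simp add: algebra_simps)
      also have "23 * \<rho> * (norm (B (Y - X)) + norm (A (Y - X) - B (Y - X)))
          \<le> 23 * \<rho> * (M * norm (Y - X) + M * norm (Y - X))"
        using \<rho> by (intro mult_left_mono add_mono M) auto
      also have "\<dots> = (46 * \<rho> * M) * norm (Y - X)" by simp
      also have "\<dots> \<le> m / 8 * norm (Y - X)"
        by (intro mult_right_mono \<rho>) auto
      finally show ?thesis .
    qed
    have "lipschitz_on (m / 8 + 2 * M) (cball 0 r) F"
    proof (rule lipschitz_onI)
      fix Y X :: 'a assume "Y \<in> cball 0 r" "X \<in> cball 0 r"
      then have "norm (F Y - F X + A (Y - X)) \<le> m / 8 * norm (Y - X)"
        using est by simp
      moreover have "norm (A (Y - X)) \<le> 2 * M * norm (Y - X)"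
        using M(2,3)[of "Y - X"] norm_triangle_ineq[of "A (Y - X) - B (Y - X)" "B (Y - X)"] by simp
      ultimately show "dist (F Y) (F X) \<le> (m / 8 + 2 * M) * dist Y X"
        using norm_triangle_ineq4[of "F Y - F X + A (Y - X)" "A (Y - X)"]
        by (simp add: dist_norm algebra_simps)
    qed (use m M in auto)
    then have "continuous_on (cball 0 r) (\<lambda>X. norm (F X))"
      by (intro continuous_on_norm lipschitz_on_continuous_on)
    then obtain X where X: "X \<in> cball 0 r" "\<And>Y. Y \<in> cball 0 r \<Longrightarrow> norm (F X) \<le> norm (F Y)"
      using continuous_attains_inf[OF compact_cball, of 0 r "\<lambda>X. norm (F X)"] r(1) by fastforce
    have F0: "F 0 = g - 1"
      using A B by (simp add: F_def bounded_linear.linear linear_0)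
    have FX: "norm (F X) \<le> \<epsilon>"
      using X(2)[of 0] r(1) F0 g by simp
    \<comment> \<open>The inner half of the ball leaves room for the correction \<open>Z\<close>,
      which will have norm at most \<open>r / 4\<close>.\<close>
    have Xr: "norm X \<le> r / 2"
    proof -
      have "m * norm X \<le> norm (A X)" by (rule m)
      also have "\<dots> \<le> norm (F X - F 0 + A X) + norm (F X) + norm (F 0)"
        using norm_triangle_ineq4[of "F X - F 0 + A X" "F X - F 0"]
          norm_triangle_ineq4[of "F X" "F 0"] by simp
      also have "\<dots> \<le> m / 8 * norm X + \<epsilon> + \<epsilon>"
        using est[of 0 X] X(1) r(1) FX F0 g by (intro add_mono) auto
      also have "\<dots> \<le> m / 8 * norm X + m * r / 4"
        using \<epsilon>(3) by simp
      finally have "m * (7 / 8 * norm X) \<le> m * (r / 4)" by (simp add: algebra_simps)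
      then have "7 / 8 * norm X \<le> r / 4" using m(1) by simp
      then show ?thesis by (simp add: field_simps) (use r(1) in linarith)
    qed
    have "F X = 0"
    proof (rule ccontr)
      assume "F X \<noteq> 0"
      then have pos: "norm (F X) > 0" by simp
      obtain Z where Z: "norm (F X - A Z) \<le> C * (norm (F X))\<^sup>2"
        using approx[OF closed[OF g(1), of X]] by (auto simp: F_def)
      have "C * (norm (F X))\<^sup>2 \<le> (\<bar>C\<bar> * \<epsilon>) * norm (F X)"
        unfolding power2_eq_square mult.assoc[symmetric]
        using FX pos by (intro mult_right_mono mult_mono) auto
      also have "\<dots> \<le> 1 / 4 * norm (F X)"
        using pos by (intro mult_right_mono \<epsilon>) auto
      finally have Z4: "norm (F X - A Z) \<le> norm (F X) / 4"
        using Z by simp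
      have "m * norm Z \<le> norm (A Z)" by (rule m)
      also have "\<dots> \<le> 2 * norm (F X)"
        using Z4 norm_triangle_sub[of "A Z" "F X"] pos
        unfolding norm_minus_commute[of "A Z"] by linarith
      finally have mZ: "m * norm Z \<le> 2 * norm (F X)" .
      have "m * norm Z \<le> m * (r / 4)"
        using mZ FX \<epsilon>(3) by simp
      then have Zr: "norm Z \<le> r / 4" using m(1) by simp
      have XZ: "norm (X + Z) \<le> r"
        using Xr Zr norm_triangle_ineq[of X Z] r(1) by simp
      \<comment> \<open>Each summand is at most a quarter of the norm of \<open>F X\<close>, because
        \<open>m * norm Z\<close> is at most twice that norm.\<close>
      have "norm (F (X + Z)) \<le> norm (F (X + Z) - F X + A Z) + norm (F X - A Z)"
        using norm_triangle_ineq[of "F (X + Z) - F X + A Z" "F X - A Z"] by simp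
      also have "\<dots> \<le> m / 8 * norm Z + norm (F X) / 4"
        using est[of X "X + Z"] X(1) XZ Z4 by simp
      also have "\<dots> < norm (F X)"
        unfolding times_divide_eq_left using mZ pos by linarith
      finally show False using X(2)[of "X + Z"] XZ by simp
    qed
    then show ?thesis using X(1) r(2) by (intro exI[of _ X]) (auto simp: F_def)
  qed
  then show ?thesis using \<epsilon>(1) by blast
qed

section \<open>The trace and the Killing form\<close>

lemma lin_trace_add: "lin_trace (\<lambda>x. f x + g x) = lin_trace f + lin_trace g"
  by (simp add: lin_trace_def inner_add_left sum.distrib)

lemma lin_trace_diff: "lin_trace (\<lambda>x. f x - g x) = lin_trace f - lin_trace g"
  by (simp add: lin_trace_def inner_diff_left sum_subtractf)

lemma lin_trace_scaleR: "lin_trace (\<lambda>x. c *\<^sub>R f x) = c * lin_trace f"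
  by (simp add: lin_trace_def sum_distrib_left)

lemma lin_trace_comp_commute:
  fixes f g :: "'a::euclidean_space \<Rightarrow> 'a"
  assumes "linear f" "linear g"
  shows "lin_trace (f \<circ> g) = lin_trace (g \<circ> f)"
proof -
  have *: "lin_trace (f \<circ> g) = (\<Sum>b\<in>Basis. \<Sum>c\<in>Basis. (g b \<bullet> c) * (f c \<bullet> b))"
    if "linear f" for f g :: "'a \<Rightarrow> 'a"
  proof -
    have "f (g b) \<bullet> b = (\<Sum>c\<in>Basis. (g b \<bullet> c) * (f c \<bullet> b))" for b
    proof -
      have "f (g b) = f (\<Sum>c\<in>Basis. (g b \<bullet> c) *\<^sub>R c)" by (simp add: euclidean_representation)
      also have "\<dots> = (\<Sum>c\<in>Basis. (g b \<bullet> c) *\<^sub>R f c)"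
        using that by (simp add: linear_sum linear_scale)
      finally show ?thesis by (simp add: inner_sum_left)
    qed
    then show ?thesis by (simp add: lin_trace_def)
  qed
  show ?thesis
    unfolding *[OF assms(1)] *[OF assms(2)] by (subst sum.swap) (simp add: mult.commute)
qed

lemma abs_lin_trace_le:
  fixes f :: "'a::euclidean_space \<Rightarrow> 'a"
  assumes "\<And>x. norm (f x) \<le> c * norm x"
  shows "\<bar>lin_trace f\<bar> \<le> real DIM('a) * c"
proof -
  have "\<bar>f b \<bullet> b\<bar> \<le> c" if "b \<in> Basis" for b
    using Cauchy_Schwarz_ineq2[of "f b" b] assms[of b] that by simp
  then have "(\<Sum>b\<in>Basis. \<bar>f b \<bullet> b\<bar>) \<le> (\<Sum>b\<in>(Basis::'a set). (c::real))"
    by (rule sum_mono)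
  then show ?thesis
    unfolding lin_trace_def by (intro order_trans[OF sum_abs]) simp
qed

section \<open>Bracket identities and invariance of the Killing form\<close>

locale lie_algebra =
  fixes br :: "'a::euclidean_space \<Rightarrow> 'a \<Rightarrow> 'a"
  assumes lie: "lie_bracket br"
begin

lemma bounded_bilinear_br: "bounded_bilinear br"
  using lie by (simp add: lie_bracket_def bilinear_conv_bounded_bilinear)

sublocale br: bounded_bilinear br
  by (rule bounded_bilinear_br)

lemma linear_br: "linear (br X)"
  by (rule bounded_linear.linear[OF br.bounded_linear_right])

lemma ad_apply [simp]: "blinfun_apply (ad br X) = br X"
  by (simp add: ad_def bounded_linear_Blinfun_apply br.bounded_linear_right)

lemma bounded_linear_ad: "bounded_linear (ad br)"
proof -
  obtain b where b: "\<And>X Y. norm (br X Y) \<le> norm X * norm Y * b" "b > 0"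
    using br.pos_bounded by blast
  have "norm (ad br X) \<le> norm X * b" for X
  proof (rule norm_blinfun_bound)
    show "norm (ad br X Y) \<le> norm X * b * norm Y" for Y
      using b(1)[of X Y] by (simp add: mult.assoc mult.commute[of b])
  qed (use b(2) in simp)
  then show ?thesis
    by (intro bounded_linear_intro[where K=b])
      (auto intro!: blinfun_eqI simp: br.add_left br.scaleR_left blinfun.bilinear_simps)
qed

lemma linear_ad: "linear (ad br)"
  by (rule bounded_linear.linear[OF bounded_linear_ad])

lemma br_self [simp]: "br X X = 0"
  using lie by (simp add: lie_bracket_def)

lemma br_antisym: "br X Y = - br Y X"
proof -
  have "br (X + Y) (X + Y) = 0" by simp
  then have "br X Y + br Y X = 0" unfolding br.add_left br.add_right by (simp add: add.commute)
  then show ?thesis by (simp add: eq_neg_iff_add_eq_0)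
qed

lemma jacobi: "br X (br Y Z) = br (br X Y) Z + br Y (br X Z)"
proof -
  have "br X (br Y Z) + br Y (br Z X) + br Z (br X Y) = 0"
    using lie by (simp add: lie_bracket_def)
  moreover have "br Z X = - br X Z" "br Z (br X Y) = - br (br X Y) Z"
    by (rule br_antisym)+
  ultimately show ?thesis by (simp add: br.minus_right algebra_simps)
qed

lemma linear_killing_left: "linear (\<lambda>X. killing br X Y)"
  by (rule linearI)
    (simp_all add: killing_def comp_def br.add_left br.scaleR_left lin_trace_add lin_trace_scaleR)

lemma killing_sym: "killing br X Y = killing br Y X"
  unfolding killing_def by (rule lin_trace_comp_commute; rule linear_br)

lemma linear_killing_right: "linear (\<lambda>Y. killing br X Y)"
  unfolding killing_sym[of X] by (rule linear_killing_left)

lemma killing_invariant: "killing br (br X Y) Z = - killing br Y (br X Z)"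
proof -
  have l: "linear (br U \<circ> br V)" for U V
    by (intro linear_compose linear_br)
  have "killing br (br X Y) Z = lin_trace (br X \<circ> (br Y \<circ> br Z)) - lin_trace (br Y \<circ> br X \<circ> br Z)"
    by (simp add: killing_def comp_def lin_trace_diff[symmetric] jacobi[of X Y])
  also have "lin_trace (br X \<circ> (br Y \<circ> br Z)) = lin_trace ((br Y \<circ> br Z) \<circ> br X)"
    by (rule lin_trace_comp_commute[OF linear_br l])
  also have "lin_trace ((br Y \<circ> br Z) \<circ> br X) - lin_trace (br Y \<circ> br X \<circ> br Z) = - killing br Y (br X Z)"
    by (simp add: killing_def comp_def lin_trace_diff[symmetric] jacobi[of X Z] br.add_right lin_trace_add)
  finally show ?thesis .
qed

lemma killing_automorphism:
  assumes "linear g" "linear h" "\<And>X. g (h X) = X" "\<And>X. h (g X) = X"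
    and "\<And>X Y. g (br X Y) = br (g X) (g Y)"
  shows "killing br (g X) (g Y) = killing br X Y"
proof -
  have "br (g X) \<circ> br (g Y) = g \<circ> (br X \<circ> br Y \<circ> h)"
    by (auto simp: assms fun_eq_iff)
  moreover have "linear (br X \<circ> br Y \<circ> h)"
    by (intro linear_compose linear_br assms)
  moreover have "br X \<circ> br Y \<circ> h \<circ> g = br X \<circ> br Y"
    by (auto simp: assms fun_eq_iff)
  ultimately show ?thesis
    unfolding killing_def using lin_trace_comp_commute[OF assms(1)] by metis
qed

section \<open>Automorphisms\<close>

lemma lie_autD:
  assumes "g \<in> lie_aut br"
  shows "bij (blinfun_apply g)" "g (br X Y) = br (g X) (g Y)"
  using assms by (auto simp: lie_aut_def)

lemma lie_autI_inverse:
  assumes "\<And>X Y. blinfun_apply g (br X Y) = br (g X) (g Y)"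
    and "\<And>X. blinfun_apply g (h X) = X" "\<And>X. h (blinfun_apply g X) = X"
  shows "g \<in> lie_aut br"
  using assms by (auto simp: lie_aut_def intro!: o_bij[of h])

lemma id_mem_lie_aut: "id_blinfun \<in> lie_aut br"
  by (rule lie_autI_inverse[where h=id]) auto

lemma compose_mem_lie_aut:
  assumes "g \<in> lie_aut br" "h \<in> lie_aut br"
  shows "g o\<^sub>L h \<in> lie_aut br"
proof -
  have "blinfun_apply (g o\<^sub>L h) = blinfun_apply g \<circ> blinfun_apply h"
    by auto
  then show ?thesis
    using assms by (auto simp: lie_aut_def intro: bij_comp)
qed

lemma lie_aut_inverse:
  assumes "g \<in> lie_aut br"
  obtains h where "h \<in> lie_aut br" "g o\<^sub>L h = id_blinfun" "h o\<^sub>L g = id_blinfun"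
    "\<And>X. g (blinfun_apply h X) = X" "\<And>X. h (blinfun_apply g X) = X"
proof -
  have b: "bij (blinfun_apply g)" using lie_autD[OF assms] by simp
  have "linear (inv (blinfun_apply g))"
    using b inj_linear_imp_inv_linear[of "blinfun_apply g"]
    by (simp add: bij_is_inj bounded_linear.linear blinfun.bounded_linear_right)
  then have bl: "bounded_linear (inv (blinfun_apply g))"
    by (simp add: linear_conv_bounded_linear)
  define h where "h = Blinfun (inv (blinfun_apply g))"
  have h: "blinfun_apply h = inv (blinfun_apply g)"
    by (simp add: h_def bounded_linear_Blinfun_apply bl)
  have gh: "g (blinfun_apply h X) = X" for X
    using b by (simp add: h surj_f_inv_f bij_is_surj)
  have hg: "h (blinfun_apply g X) = X" for X
    using b by (simp add: h inv_f_f bij_is_inj)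
  have "h (br X Y) = br (h X) (h Y)" for X Y
    using lie_autD(2)[OF assms, of "h X" "h Y"] hg[of "br (h X) (h Y)"] by (simp add: gh)
  then have "h \<in> lie_aut br"
    by (rule lie_autI_inverse[where h=g]) (simp_all add: gh hg)
  with gh hg show ?thesis
    by (intro that[of h]) (auto intro: blinfun_eqI)
qed

lemma ad_automorphism:
  assumes "g \<in> lie_aut br" "g o\<^sub>L h = id_blinfun"
  shows "g o\<^sub>L ad br X o\<^sub>L h = ad br (g X)"
proof (rule blinfun_eqI)
  fix Y
  have "g (h Y) = Y" using arg_cong[OF assms(2), of "\<lambda>f. blinfun_apply f Y"] by simp
  then show "(g o\<^sub>L ad br X o\<^sub>L h) Y = ad br (g X) Y"
    by (simp add: lie_autD(2)[OF assms(1)])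
qed

lemma blinfun_exp_apply_inverse:
  "blinfun_exp D (blinfun_exp (- D) X) = X" "blinfun_exp (- D) (blinfun_exp D X) = X"
  using arg_cong[OF blinfun_exp_inverse(1)[of D], of "\<lambda>f. blinfun_apply f X"]
    arg_cong[OF blinfun_exp_inverse(2)[of D], of "\<lambda>f. blinfun_apply f X"] by simp_all

lemma blinfun_exp_commute_apply:
  "blinfun_apply (blinfun_exp (t *\<^sub>R D)) (D X) = D (blinfun_exp (t *\<^sub>R D) X)"
  using arg_cong[OF blinfun_exp_commute[of t D], of "\<lambda>f. blinfun_apply f X"] by simp

text \<open>For a derivation \<open>D\<close> the curve \<open>t \<mapsto> exp (- t D) [exp (t D) Y, exp (t D) Z]\<close>
  has derivative zero.\<close>

lemma blinfun_exp_ad_mem_lie_aut: "blinfun_exp (ad br X) \<in> lie_aut br"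
proof (rule lie_autI_inverse[where h="blinfun_exp (- ad br X)"])
  fix Y Z
  define D where "D = ad br X"
  have der: "D (br U V) = br (D U) V + br U (D V)" for U V
    by (simp add: D_def jacobi[of X])
  define e where "e t = blinfun_exp (t *\<^sub>R D)" for t
  define f where "f t = blinfun_exp (t *\<^sub>R (- D)) (br (e t Y) (e t Z))" for t
  have "(f has_vector_derivative 0) (at t within UNIV)" for t
  proof -
    have d: "((\<lambda>t. e t U) has_vector_derivative D (e t U)) (at t within UNIV)" for U
      unfolding e_def
      using bounded_linear.has_vector_derivative[OF blinfun.bounded_linear_left
          has_vector_derivative_blinfun_exp[of D t UNIV], of U]
      by (simp add: blinfun_exp_commute_apply)
    have "((\<lambda>t. br (e t Y) (e t Z)) has_vector_derivative D (br (e t Y) (e t Z))) (at t within UNIV)"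
      using bounded_bilinear.has_vector_derivative[OF bounded_bilinear_br d d, of Y Z]
      by (simp add: der add.commute)
    from bounded_bilinear.has_vector_derivative[OF bounded_bilinear_blinfun_apply
        has_vector_derivative_blinfun_exp[of "- D"] this]
    show ?thesis
      unfolding f_def by (simp add: blinfun.bilinear_simps)
  qed
  then have "f 1 = f 0"
    using has_derivative_zero_constant[of UNIV f]
    by (auto simp: has_vector_derivative_def)
  then have "blinfun_exp (- D) (br (blinfun_exp D Y) (blinfun_exp D Z)) = br Y Z"
    by (simp add: f_def e_def blinfun_exp_0)
  then have "blinfun_exp D (br Y Z) = br (blinfun_exp D Y) (blinfun_exp D Z)"
    using blinfun_exp_apply_inverse(1)[of D] by metis
  then show "blinfun_exp (ad br X) (br Y Z) = br (blinfun_exp (ad br X) Y) (blinfun_exp (ad br X) Z)"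
    by (simp add: D_def)
qed (simp_all add: blinfun_exp_apply_inverse)

lemma lie_aut0_subset: "lie_aut0 br \<subseteq> lie_aut br"
  by (simp add: lie_aut0_def connected_component_subset)

lemma id_mem_lie_aut0: "id_blinfun \<in> lie_aut0 br"
  by (simp add: lie_aut0_def id_mem_lie_aut connected_component_refl)

lemma connected_lie_aut0: "connected (lie_aut0 br)"
  by (simp add: lie_aut0_def)

lemma lie_aut0_maximal:
  "connected S \<Longrightarrow> S \<subseteq> lie_aut br \<Longrightarrow> id_blinfun \<in> S \<Longrightarrow> S \<subseteq> lie_aut0 br"
  unfolding lie_aut0_def by (intro connected_component_maximal)

lemma blinfun_exp_ad_mem_lie_aut0: "blinfun_exp (ad br X) \<in> lie_aut0 br"
proof -
  let ?S = "range (\<lambda>t::real. blinfun_exp (t *\<^sub>R ad br X))"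
  have "continuous (at t within UNIV) (\<lambda>t. blinfun_exp (t *\<^sub>R ad br X))" for t
    by (rule has_vector_derivative_continuous[OF has_vector_derivative_blinfun_exp])
  then have "connected ?S"
    by (intro connected_continuous_image) (auto simp: continuous_on_eq_continuous_within)
  moreover have "t *\<^sub>R ad br X = ad br (t *\<^sub>R X)" for t
    by (simp add: linear_scale[OF linear_ad])
  then have "?S \<subseteq> lie_aut br"
    using blinfun_exp_ad_mem_lie_aut by auto
  moreover have "id_blinfun \<in> ?S"
    by (intro image_eqI[of _ _ 0]) (auto simp: blinfun_exp_0)
  ultimately have "?S \<subseteq> lie_aut0 br"
    by (rule lie_aut0_maximal)
  then show ?thesis
    by (metis rangeI scaleR_one subsetD)
qed

text \<open>The products of elements of a connected set through the identity again form a connected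
  set through the identity, to which maximality of the component applies.\<close>

lemma compose_mem_lie_aut0:
  assumes "g \<in> lie_aut0 br" "h \<in> lie_aut0 br"
  shows "g o\<^sub>L h \<in> lie_aut0 br"
proof -
  let ?S = "(\<lambda>(g, h). g o\<^sub>L h) ` (lie_aut0 br \<times> lie_aut0 br)"
  have "connected ?S"
    by (intro connected_continuous_image connected_Times connected_lie_aut0)
      (auto simp: case_prod_unfold intro!: continuous_intros)
  moreover have "?S \<subseteq> lie_aut br"
    using lie_aut0_subset compose_mem_lie_aut by auto
  moreover have "id_blinfun \<in> ?S"
    using id_mem_lie_aut0 by (intro image_eqI[of _ _ "(id_blinfun, id_blinfun)"]) (auto intro: blinfun_eqI)
  ultimately have "?S \<subseteq> lie_aut0 br"
    by (rule lie_aut0_maximal)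
  then show ?thesis using assms by auto
qed

end

section \<open>The inner product of a Cartan involution\<close>

locale cartan_lie_algebra = lie_algebra +
  fixes \<theta> :: "'a \<Rightarrow> 'a"
  assumes cartan: "cartan_involution br \<theta>"
begin

lemma linear_theta: "linear \<theta>"
  using cartan by (simp add: cartan_involution_def)

lemma theta_theta [simp]: "\<theta> (\<theta> X) = X"
  using cartan by (simp add: cartan_involution_def)

lemma theta_br: "\<theta> (br X Y) = br (\<theta> X) (\<theta> Y)"
  using cartan by (simp add: cartan_involution_def)

lemma bounded_linear_theta: "bounded_linear \<theta>"
  using linear_theta by (simp add: linear_conv_bounded_linear)

text \<open>Unlike the inner product of the type, this one fits the bracket: \<open>br A\<close> is
  symmetric when \<open>\<theta> A = - A\<close>, and automorphisms commuting with
  \<open>\<theta>\<close> are isometries.\<close>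

definition ip :: "'a \<Rightarrow> 'a \<Rightarrow> real" where
  "ip X Y = - killing br X (\<theta> Y)"

lemma ip_pos: "X \<noteq> 0 \<Longrightarrow> ip X X > 0"
  using cartan by (simp add: cartan_involution_def ip_def)

lemma bilinear_ip: "bilinear ip"
  using linear_compose[OF linear_theta linear_killing_right]
  by (auto simp: bilinear_def ip_def comp_def intro!: linear_compose_neg linear_killing_left)

lemma bounded_bilinear_ip: "bounded_bilinear ip"
  using bilinear_ip by (simp add: bilinear_conv_bounded_bilinear)

sublocale ip: bounded_bilinear ip
  by (rule bounded_bilinear_ip)

lemma killing_theta: "killing br (\<theta> X) (\<theta> Y) = killing br X Y"
  by (rule killing_automorphism[where h=\<theta>]) (auto simp: linear_theta theta_br)

lemma ip_sym: "ip X Y = ip Y X"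
  using killing_theta[of X "\<theta> Y"] by (simp add: ip_def killing_sym)

lemma ip_self_eq_0_iff: "ip X X = 0 \<longleftrightarrow> X = 0"
  using ip_pos[of X] by (cases "X = 0") (auto simp: ip.zero_left)

text \<open>Compactness of the unit sphere makes positivity uniform. The constant translates between
  \<open>ip\<close> and the norm in which all estimates are stated.\<close>

lemma ip_ge_norm: obtains c where "c > 0" "\<And>X. c * (norm X)\<^sup>2 \<le> ip X X"
proof -
  have "continuous_on (sphere 0 1) (\<lambda>X. ip X X)"
    by (intro ip.continuous_on continuous_intros)
  moreover have "sphere (0::'a) 1 \<noteq> {}" by simp
  ultimately obtain U where U: "U \<in> sphere 0 1" "\<And>Y. Y \<in> sphere 0 1 \<Longrightarrow> ip U U \<le> ip Y Y"
    using continuous_attains_inf[OF compact_sphere, of 0 1 "\<lambda>X. ip X X"] by auto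
  have "ip U U * (norm X)\<^sup>2 \<le> ip X X" for X
  proof (cases "X = 0")
    case False
    have "ip U U \<le> ip (X /\<^sub>R norm X) (X /\<^sub>R norm X)"
      using False by (intro U) simp
    also have "\<dots> = ip X X / (norm X)\<^sup>2"
      by (simp add: ip.scaleR_left ip.scaleR_right power2_eq_square divide_simps)
    finally show ?thesis using False by (simp add: pos_le_divide_eq)
  qed (simp add: ip.zero_left)
  moreover have "ip U U > 0" using U(1) by (intro ip_pos) auto
  ultimately show ?thesis using that by blast
qed

text \<open>\<open>M\<close> is the Killing form as a matrix for the inner product of the type.
  Testing \<open>M Z\<close> on \<open>\<theta> Z\<close> shows that it is injective, hence
  onto.\<close>

lemma functional_eq_killing:
  assumes "linear f"
  obtains Z where "\<And>X. f X = killing br Z X"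
proof -
  define M where "M Z = (\<Sum>b\<in>Basis. killing br Z b *\<^sub>R b)" for Z
  have M: "M Z \<bullet> X = killing br Z X" for Z X
  proof -
    have "killing br Z X = killing br Z (\<Sum>b\<in>Basis. (X \<bullet> b) *\<^sub>R b)"
      by (simp add: euclidean_representation)
    also have "\<dots> = M Z \<bullet> X"
      using linear_killing_right[of Z]
      by (simp add: linear_sum linear_scale M_def inner_sum_left inner_sum_right
          inner_commute mult.commute)
    finally show ?thesis by simp
  qed
  have lin: "linear M"
    by (intro linearI) (simp_all add: M_def linear_add[OF linear_killing_left]
        linear_scale[OF linear_killing_left] scaleR_add_left sum.distrib scaleR_sum_right)
  have "Z = 0" if "M Z = 0" for Z
    using M[of Z "\<theta> Z"] that ip_pos[of Z] by (cases "Z = 0") (auto simp: ip_def)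
  then have "surj M"
    using lin by (intro linear_injective_imp_surjective) (auto simp: linear_injective_0)
  then obtain Z where Z: "M Z = (\<Sum>b\<in>Basis. f b *\<^sub>R b)" by (metis surjD)
  have "f X = killing br Z X" for X
  proof -
    have "f X = f (\<Sum>b\<in>Basis. (X \<bullet> b) *\<^sub>R b)"
      by (simp add: euclidean_representation)
    also have "\<dots> = M Z \<bullet> X"
      unfolding Z using assms
      by (simp add: linear_sum linear_scale inner_sum_left inner_commute[of X] mult.commute)
    finally show ?thesis by (simp add: M)
  qed
  then show ?thesis using that by blast
qed

text \<open>Up to sign \<open>ip X X\<close> is a trace with \<open>br X\<close> as one factor, so
  it is at most a constant times \<open>norm (ad br X) * norm X\<close>.\<close>

lemma ad_bounded_below: obtains m where "m > 0" "\<And>X. m * norm X \<le> norm (ad br X)"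
proof -
  obtain c where c: "c > 0" "\<And>X. c * (norm X)\<^sup>2 \<le> ip X X" using ip_ge_norm by blast
  obtain b where b: "b > 0" "\<And>X Y. norm (br X Y) \<le> norm X * norm Y * b"
    using br.pos_bounded by blast
  obtain t where t: "t > 0" "\<And>X. norm (\<theta> X) \<le> norm X * t"
    using bounded_linear.pos_bounded[OF bounded_linear_theta] by blast
  define d where "d = real DIM('a) * b * t"
  have d: "d > 0" using b(1) t(1) by (simp add: d_def)
  have "c / d * norm X \<le> norm (ad br X)" for X
  proof (cases "X = 0")
    case False
    have "norm ((br X \<circ> br (\<theta> X)) Y) \<le> (norm (ad br X) * (norm X * t * b)) * norm Y" for Y
    proof -
      have "norm (br X (br (\<theta> X) Y)) \<le> norm (ad br X) * norm (br (\<theta> X) Y)"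
        using norm_blinfun[of "ad br X"] by simp
      also have "\<dots> \<le> norm (ad br X) * ((norm X * t) * norm Y * b)"
        by (intro mult_left_mono order_trans[OF b(2)] mult_right_mono t) (use b in auto)
      finally show ?thesis by (simp add: ac_simps)
    qed
    from abs_lin_trace_le[OF this]
    have "ip X X \<le> real DIM('a) * (norm (ad br X) * (norm X * t * b))"
      by (simp add: ip_def killing_def comp_def)
    with c(2)[of X] have "(c * norm X) * norm X \<le> (d * norm (ad br X)) * norm X"
      by (simp add: power2_eq_square d_def ac_simps)
    then have "c * norm X \<le> d * norm (ad br X)" using False by simp
    then show ?thesis using d by (simp add: field_simps)
  qed simp
  then show ?thesis using c(1) d that[of "c / d"] by simp
qed

lemma ad_inj: "ad br X = ad br Y \<Longrightarrow> X = Y"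
proof -
  obtain m where m: "m > 0" "\<And>X. m * norm X \<le> norm (ad br X)" using ad_bounded_below by blast
  assume "ad br X = ad br Y"
  then have "ad br (X - Y) = 0" by (simp add: linear_diff[OF linear_ad])
  then have "m * norm (X - Y) \<le> 0" using m(2)[of "X - Y"] by simp
  then show "X = Y" using m(1) by (simp add: mult_le_0_iff)
qed

text \<open>With \<open>E = h - 1\<close> the automorphism property reads
  \<open>E [X, W] = [E X, W] + [X, E W] + [E X, E W]\<close>, so \<open>E\<close> is a derivation up to second order.
  Choosing \<open>Z\<close> with \<open>tr (E ad X) = killing Z X\<close> for all \<open>X\<close>, the argument by which
  derivations are inner also bounds the error.\<close>

lemma lie_aut_minus_id_near_ad:
  obtains C where "\<And>h. h \<in> lie_aut br \<Longrightarrow>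
    \<exists>Z. norm (h - id_blinfun - ad br Z) \<le> C * (norm (h - id_blinfun))\<^sup>2"
proof -
  obtain c where c: "c > 0" "\<And>X. c * (norm X)\<^sup>2 \<le> ip X X" using ip_ge_norm by blast
  obtain b where b: "b > 0" "\<And>X Y. norm (br X Y) \<le> norm X * norm Y * b"
    using br.pos_bounded by blast
  obtain t where t: "t > 0" "\<And>X. norm (\<theta> X) \<le> norm X * t"
    using bounded_linear.pos_bounded[OF bounded_linear_theta] by blast
  define d where "d = real DIM('a) * b\<^sup>2 * t"
  have "\<exists>Z. norm (h - id_blinfun - ad br Z) \<le> d / c * (norm (h - id_blinfun))\<^sup>2"
    if h: "h \<in> lie_aut br" for h
  proof -
    define E where "E = h - id_blinfun"
    define N where "N = norm E"
    have hE: "h X = X + E X" for X by (simp add: E_def blinfun.diff_left)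
    have E: "E (br X W) = br (E X) W + br X (E W) + br (E X) (E W)" for X W
      using lie_autD(2)[OF h, of X W] unfolding hE br.add_left br.add_right by (simp add: algebra_simps)
    have "linear (\<lambda>X. lin_trace (blinfun_apply E \<circ> br X))"
      by (rule linearI) (simp_all add: comp_def br.add_left br.scaleR_left blinfun.bilinear_simps
          lin_trace_add lin_trace_scaleR)
    then obtain Z where Z: "\<And>X. lin_trace (blinfun_apply E \<circ> br X) = killing br Z X"
      using functional_eq_killing by blast
    define F where "F X = E X - br Z X" for X
    have linF: "linear F"
      unfolding F_def
      by (intro linear_compose_sub linear_br bounded_linear.linear blinfun.bounded_linear_right)
    have F: "br (F X) W = F (br X W) - br X (F W) - br (E X) (E W)" for X W
      unfolding F_def E jacobi[of Z] br.diff_left br.diff_right by (simp add: algebra_simps)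
    have trF: "lin_trace (F \<circ> br X) = 0" for X
      using Z[of X] by (simp add: F_def comp_def lin_trace_diff killing_def)
    \<comment> \<open>By the twisted Leibniz rule \<open>F\<close>, the first-order part of the
      trace is \<open>lin_trace (F \<circ> br (br X Y))\<close>, which vanishes by the choice of
      \<open>Z\<close>. Only the term quadratic in \<open>E\<close> remains.\<close>
    have key: "killing br (F X) Y = - lin_trace (\<lambda>W. br (E X) (E (br Y W)))" for X Y
    proof -
      have l: "linear (F \<circ> br Y)" by (intro linear_compose linear_br linF)
      have "killing br (F X) Y = lin_trace (F \<circ> (br X \<circ> br Y)) - lin_trace (br X \<circ> (F \<circ> br Y))
          - lin_trace (\<lambda>W. br (E X) (E (br Y W)))"
        by (simp add: killing_def comp_def F lin_trace_diff)
      also have "lin_trace (br X \<circ> (F \<circ> br Y)) = lin_trace ((F \<circ> br Y) \<circ> br X)"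
        by (rule lin_trace_comp_commute[OF linear_br l])
      also have "lin_trace (F \<circ> (br X \<circ> br Y)) = lin_trace (F \<circ> br (br X Y)) + lin_trace ((F \<circ> br Y) \<circ> br X)"
        by (simp add: comp_def jacobi[of X Y] linear_add[OF linF] lin_trace_add)
      finally show ?thesis using trF[of "br X Y"] by (simp add: comp_def)
    qed
    have "norm (F X) \<le> d / c * N\<^sup>2 * norm X" for X
    proof (cases "F X = 0")
      case False
      \<comment> \<open>Testing against \<open>\<theta> (F X)\<close> turns the Killing form into
        \<open>- ip (F X) (F X)\<close>; one factor \<open>norm (F X)\<close> is divided out
        below.\<close>
      let ?Y = "\<theta> (F X)"
      have "norm (br (E X) (E (br ?Y W))) \<le> (N * norm X * (N * (norm (F X) * t * b)) * b) * norm W" for W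
      proof -
        have "norm (E X) \<le> N * norm X" "norm (E (br ?Y W)) \<le> N * norm (br ?Y W)"
          by (simp_all add: N_def norm_blinfun)
        moreover have "N * norm (br ?Y W) \<le> N * ((norm (F X) * t) * norm W * b)"
          by (intro mult_left_mono order_trans[OF b(2)] mult_right_mono t) (use b in \<open>auto simp: N_def\<close>)
        ultimately have "norm (E X) * norm (E (br ?Y W)) * b
            \<le> (N * norm X) * (N * ((norm (F X) * t) * norm W * b)) * b"
          using b t by (intro mult_mono mult_nonneg_nonneg) (auto simp: N_def)
        then show ?thesis using order_trans[OF b(2)[of "E X" "E (br ?Y W)"]] by (simp add: ac_simps)
      qed
      from abs_lin_trace_le[OF this]
      have "ip (F X) (F X) \<le> real DIM('a) * (N * norm X * (N * (norm (F X) * t * b)) * b)"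
        by (auto simp: ip_def key)
      with c(2)[of "F X"] have "(c * norm (F X)) * norm (F X) \<le> (d * N\<^sup>2 * norm X) * norm (F X)"
        by (simp add: power2_eq_square d_def ac_simps)
      then have "c * norm (F X) \<le> d * N\<^sup>2 * norm X" using False by simp
      then show ?thesis using c by (simp add: field_simps)
    qed (use c t in \<open>auto simp: d_def intro!: mult_nonneg_nonneg divide_nonneg_nonneg\<close>)
    then have "norm (E - ad br Z) \<le> d / c * N\<^sup>2"
      using c t by (intro norm_blinfun_bound) (auto simp: F_def blinfun.diff_left d_def)
    then show ?thesis by (auto simp: E_def N_def)
  qed
  then show ?thesis by (rule that)
qed

section \<open>Exponential coordinates on the automorphism group\<close>

text \<open>The map \<open>\<kappa>\<close> decides how the coordinate \<open>X\<close> is shared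
  between the two factors, and \<open>\<delta>\<close> allows \<open>X\<close> to be kept where the
  exponential is injective.\<close>

lemma lie_aut_chart:
  assumes \<kappa>: "linear \<kappa>" and \<delta>: "\<delta> > 0"
  obtains \<epsilon> where "\<epsilon> > 0" "\<And>g. g \<in> lie_aut br \<Longrightarrow> norm (g - id_blinfun) < \<epsilon> \<Longrightarrow>
    \<exists>X. norm X \<le> \<delta> \<and> g = blinfun_exp (ad br (\<kappa> X)) o\<^sub>L blinfun_exp (ad br (X - \<kappa> X))"
proof -
  define A where "A X = Endo (ad br X)" for X
  define B where "B X = Endo (ad br (\<kappa> X))" for X
  have A: "bounded_linear A"
    unfolding A_def by (rule bounded_linear_compose[OF bounded_linear_Endo bounded_linear_ad])
  have B: "bounded_linear B"
    unfolding B_def using \<kappa>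
    by (intro bounded_linear_compose[OF bounded_linear_Endo]
        bounded_linear_compose[OF bounded_linear_ad]) (simp add: linear_conv_bounded_linear)
  have AB: "A X - B X = Endo (ad br (X - \<kappa> X))" for X
    by (simp add: A_def B_def minus_endo.abs_eq linear_diff[OF linear_ad])
  obtain m where m: "m > 0" "\<And>X. m * norm X \<le> norm (ad br X)" using ad_bounded_below by blast
  obtain C where C: "\<And>h. h \<in> lie_aut br \<Longrightarrow>
      \<exists>Z. norm (h - id_blinfun - ad br Z) \<le> C * (norm (h - id_blinfun))\<^sup>2"
    using lie_aut_minus_id_near_ad by blast
  have e: "exp (- Endo (ad br X)) = Endo (blinfun_exp (ad br (- X)))"
    "exp (Endo (ad br X)) = Endo (blinfun_exp (ad br X))" for X
    by (simp_all add: blinfun_exp_conv_endo of_endo_inverse uminus_endo.abs_eq linear_neg[OF linear_ad])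
  have "\<exists>\<epsilon>>0. \<forall>g\<in>Endo ` lie_aut br. norm (g - 1) < \<epsilon> \<longrightarrow>
    (\<exists>X. norm X \<le> \<delta> \<and> exp (- B X) * g * exp (- (A X - B X)) = 1)"
  proof (rule local_product_chart[OF A B m(1) _ _ _ \<delta>])
    show "m * norm X \<le> norm (A X)" for X
      using m(2) by (simp add: A_def norm_endo.abs_eq)
    show "\<exists>Z. norm (h - 1 - A Z) \<le> C * (norm (h - 1))\<^sup>2" if "h \<in> Endo ` lie_aut br" for h
      using that C
      by (auto simp: A_def one_endo_def minus_endo.abs_eq norm_endo.abs_eq)
    show "exp (- B X) * g * exp (- (A X - B X)) \<in> Endo ` lie_aut br"
      if "g \<in> Endo ` lie_aut br" for g X
      using that unfolding AB unfolding B_def e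
      by (auto simp: times_endo.abs_eq intro!: imageI compose_mem_lie_aut blinfun_exp_ad_mem_lie_aut)
  qed
  then obtain \<epsilon> where \<epsilon>: "\<epsilon> > 0" "\<And>g. g \<in> lie_aut br \<Longrightarrow> norm (g - id_blinfun) < \<epsilon> \<Longrightarrow>
    \<exists>X. norm X \<le> \<delta> \<and> exp (- B X) * Endo g * exp (- (A X - B X)) = 1"
    by (auto simp: one_endo_def minus_endo.abs_eq norm_endo.abs_eq)
  have "\<exists>X. norm X \<le> \<delta> \<and> g = blinfun_exp (ad br (\<kappa> X)) o\<^sub>L blinfun_exp (ad br (X - \<kappa> X))"
    if g: "g \<in> lie_aut br" "norm (g - id_blinfun) < \<epsilon>" for g
  proof -
    obtain X where X: "norm X \<le> \<delta>" "exp (- B X) * Endo g * exp (- (A X - B X)) = 1"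
      using \<epsilon>(2)[OF g] by blast
    have "Endo g = exp (B X) * (exp (- B X) * Endo g * exp (- (A X - B X))) * exp (A X - B X)"
      using exp_minus_inverse[of "B X"] exp_minus_inverse[of "- (A X - B X)"]
      by (metis (no_types, lifting) minus_minus mult.assoc mult.left_neutral mult.right_neutral)
    also have "\<dots> = exp (B X) * exp (A X - B X)" unfolding X(2) by simp
    also have "\<dots> = Endo (blinfun_exp (ad br (\<kappa> X)) o\<^sub>L blinfun_exp (ad br (X - \<kappa> X)))"
      unfolding AB unfolding B_def e by (simp add: times_endo.abs_eq)
    finally show ?thesis using X(1) by (auto simp: Endo_inject)
  qed
  then show ?thesis using \<epsilon>(1) that by blast
qed

end

text \<open>With \<open>\<rho> = 1 / 4\<close> the exponential differs from the identity map by a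
  map with Lipschitz constant \<open>1 / 2\<close>.\<close>

lemma blinfun_exp_inj_small:
  assumes "norm D \<le> 1 / 4" "norm D' \<le> 1 / 4" "blinfun_exp D = blinfun_exp D'"
  shows "D = D'"
proof -
  have "exp (Endo D) = exp (Endo D')"
    using assms(3) by (simp add: blinfun_exp_conv_endo of_endo_inject)
  then have "norm (Endo D - Endo D') \<le> 1 / 2 * norm (Endo D - Endo D')"
    using norm_exp_diff_minus_diff_le[of "Endo D" "1 / 4" "Endo D'"] assms
    by (simp add: norm_endo.abs_eq norm_minus_commute)
  then show ?thesis by (simp add: Endo_inject)
qed

section \<open>Automorphisms near the identity that commute with the Cartan involution\<close>

context cartan_lie_algebra
begin

lemma theta_decomposition:
  obtains U V where "X = U + V" "\<theta> U = U" "\<theta> V = - V"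
proof
  show "X = (1/2) *\<^sub>R (X + \<theta> X) + (1/2) *\<^sub>R (X - \<theta> X)"
    by (simp add: algebra_simps flip: scaleR_left.add)
  show "\<theta> ((1/2) *\<^sub>R (X + \<theta> X)) = (1/2) *\<^sub>R (X + \<theta> X)"
    "\<theta> ((1/2) *\<^sub>R (X - \<theta> X)) = - ((1/2) *\<^sub>R (X - \<theta> X))"
    using linear_theta by (simp_all add: linear_add linear_diff linear_scale algebra_simps)
qed

lemma killing_lie_aut:
  assumes "g \<in> lie_aut br"
  shows "killing br (g X) (g Y) = killing br X Y"
proof -
  obtain h where h: "\<And>X. g (blinfun_apply h X) = X" "\<And>X. h (blinfun_apply g X) = X"
    using lie_aut_inverse[OF assms] by metis
  show ?thesis
    by (rule killing_automorphism[where h="blinfun_apply h"])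
      (auto simp: h lie_autD[OF assms] bounded_linear.linear blinfun.bounded_linear_right)
qed

lemma ip_lie_aut:
  assumes "g \<in> lie_aut br" "\<And>X. \<theta> (blinfun_apply g X) = g (\<theta> X)"
  shows "ip (g X) (g Y) = ip X Y"
  unfolding ip_def assms(2) killing_lie_aut[OF assms(1)] ..

lemma blinfun_exp_ad_theta:
  assumes "\<And>Y. \<theta> (blinfun_exp (ad br X) Y) = blinfun_exp (ad br X) (\<theta> Y)"
  shows "blinfun_exp (ad br (\<theta> X)) = blinfun_exp (ad br X)"
proof -
  define \<Theta> where "\<Theta> = Blinfun \<theta>"
  have \<Theta>: "blinfun_apply \<Theta> = \<theta>"
    by (simp add: \<Theta>_def bounded_linear_Blinfun_apply bounded_linear_theta)
  have "\<Theta> o\<^sub>L \<Theta> = id_blinfun" by (intro blinfun_eqI) (simp add: \<Theta>)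
  from blinfun_exp_conjugate[OF this this, of "ad br X"]
  have "\<Theta> o\<^sub>L blinfun_exp (ad br X) o\<^sub>L \<Theta> = blinfun_exp (\<Theta> o\<^sub>L ad br X o\<^sub>L \<Theta>)" .
  moreover have "\<Theta> o\<^sub>L ad br X o\<^sub>L \<Theta> = ad br (\<theta> X)"
    by (intro blinfun_eqI) (simp add: \<Theta> theta_br)
  moreover have "\<Theta> o\<^sub>L blinfun_exp (ad br X) o\<^sub>L \<Theta> = blinfun_exp (ad br X)"
    by (intro blinfun_eqI) (simp add: \<Theta> assms)
  ultimately show ?thesis by simp
qed

text \<open>Conjugation by \<open>\<theta>\<close> turns \<open>blinfun_exp (ad br X)\<close> into
  \<open>blinfun_exp (ad br (\<theta> X))\<close>. If \<open>g\<close> commutes with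
  \<open>\<theta>\<close> the two agree, and injectivity for small arguments forces
  \<open>\<theta> X = X\<close>.\<close>

lemma theta_commuting_lie_aut_near_id:
  obtains \<epsilon> where "\<epsilon> > 0" "\<And>g. g \<in> lie_aut br \<Longrightarrow> norm (g - id_blinfun) < \<epsilon> \<Longrightarrow>
    (\<And>X. \<theta> (blinfun_apply g X) = g (\<theta> X)) \<Longrightarrow> \<exists>X. \<theta> X = X \<and> g = blinfun_exp (ad br X)"
proof -
  obtain b where b: "b > 0" "\<And>X. norm (ad br X) \<le> norm X * b"
    using bounded_linear.pos_bounded[OF bounded_linear_ad] by blast
  obtain t where t: "t > 0" "\<And>X. norm (\<theta> X) \<le> norm X * t"
    using bounded_linear.pos_bounded[OF bounded_linear_theta] by blast
  \<comment> \<open>Small enough that \<open>ad br X\<close> and \<open>ad br (\<theta> X)\<close>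
    both have norm at most \<open>1 / 4\<close>.\<close>
  define \<delta> where "\<delta> = 1 / (4 * b * (1 + t))"
  have \<delta>: "\<delta> > 0" using b t by (simp add: \<delta>_def)
  obtain \<epsilon> where \<epsilon>: "\<epsilon> > 0" "\<And>g. g \<in> lie_aut br \<Longrightarrow> norm (g - id_blinfun) < \<epsilon> \<Longrightarrow>
    \<exists>X. norm X \<le> \<delta> \<and> g = blinfun_exp (ad br X) o\<^sub>L blinfun_exp (ad br (X - X))"
    using lie_aut_chart[OF linear_ident \<delta>] by blast
  have "\<exists>X. \<theta> X = X \<and> g = blinfun_exp (ad br X)"
    if g: "g \<in> lie_aut br" "norm (g - id_blinfun) < \<epsilon>"
      "\<And>X. \<theta> (blinfun_apply g X) = g (\<theta> X)" for g
  proof -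
    obtain X where X: "norm X \<le> \<delta>" "g = blinfun_exp (ad br X) o\<^sub>L blinfun_exp (ad br (X - X))"
      using \<epsilon>(2)[OF g(1,2)] by blast
    have gX: "g = blinfun_exp (ad br X)"
      by (rule blinfun_eqI) (simp add: X(2) linear_0[OF linear_ad] blinfun_exp_0)
    have "norm (ad br Y) \<le> 1 / 4" if "norm Y \<le> \<delta> * (1 + t)" for Y
    proof -
      have "norm (ad br Y) \<le> (\<delta> * (1 + t)) * b"
        using that b by (intro order_trans[OF b(2)] mult_right_mono) auto
      also have "\<dots> = 1 / 4" using b(1) t(1) by (simp add: \<delta>_def)
      finally show ?thesis .
    qed
    moreover have "norm X \<le> \<delta> * (1 + t)"
      unfolding distrib_left using X(1) mult_pos_pos[OF \<delta> t(1)] by linarith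
    moreover have "norm (\<theta> X) \<le> \<delta> * (1 + t)"
      unfolding distrib_left using t(2)[of X] mult_right_mono[OF X(1), of t] \<delta> t(1) by linarith
    moreover have "blinfun_exp (ad br (\<theta> X)) = blinfun_exp (ad br X)"
      using g(3) unfolding gX by (rule blinfun_exp_ad_theta)
    ultimately have "ad br (\<theta> X) = ad br X"
      using blinfun_exp_inj_small by blast
    then show ?thesis using gX ad_inj by blast
  qed
  then show ?thesis using \<epsilon>(1) that by blast
qed

end

section \<open>The maximal compact subgroup\<close>

locale cartan_subgroup = cartan_lie_algebra +
  fixes K :: "('a \<Rightarrow>\<^sub>L 'a) set"
  assumes K: "connected_subgroup_with_lie_algebra br {X. \<theta> X = X} K"
begin

lemma K_lie_aut0: "g \<in> K \<Longrightarrow> g \<in> lie_aut0 br"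
  using K by (auto simp: connected_subgroup_with_lie_algebra_def)

lemma K_lie_aut: "g \<in> K \<Longrightarrow> g \<in> lie_aut br"
  using K_lie_aut0 lie_aut0_subset by blast

lemma K_id: "id_blinfun \<in> K"
  and K_compose: "g \<in> K \<Longrightarrow> h \<in> K \<Longrightarrow> g o\<^sub>L h \<in> K"
  using K by (auto simp: connected_subgroup_with_lie_algebra_def linear_subgroup_def)

lemma K_inverse:
  assumes "g \<in> K"
  obtains h where "h \<in> K" "g o\<^sub>L h = id_blinfun" "h o\<^sub>L g = id_blinfun"
    "\<And>X. g (blinfun_apply h X) = X" "\<And>X. h (blinfun_apply g X) = X"
proof -
  obtain h where h: "h \<in> K" "g o\<^sub>L h = id_blinfun" "h o\<^sub>L g = id_blinfun"
    using K assms by (auto simp: connected_subgroup_with_lie_algebra_def linear_subgroup_def)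
  moreover have "g (blinfun_apply h X) = X" "h (blinfun_apply g X) = X" for X
    using arg_cong[OF h(2), of "\<lambda>f. blinfun_apply f X"]
      arg_cong[OF h(3), of "\<lambda>f. blinfun_apply f X"] by simp_all
  ultimately show ?thesis using that by blast
qed

lemma lie_algebra_of_K: "lie_algebra_of K = ad br ` {X. \<theta> X = X}"
  using K by (simp add: connected_subgroup_with_lie_algebra_def)

lemma blinfun_exp_scaled_mem_K: "\<theta> X = X \<Longrightarrow> blinfun_exp (t *\<^sub>R ad br X) \<in> K"
  using lie_algebra_of_K by (auto simp: lie_algebra_of_def)

lemma blinfun_exp_mem_K: "\<theta> X = X \<Longrightarrow> blinfun_exp (ad br X) \<in> K"
  using blinfun_exp_scaled_mem_K[of X 1] by simp

text \<open>A group normalizes its Lie algebra: conjugation by \<open>g\<close> takes the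
  one-parameter group of \<open>ad br X\<close> to that of \<open>ad br (g X)\<close>, still inside
  \<open>K\<close>.\<close>

lemma K_preserves_fixed:
  assumes g: "g \<in> K" and X: "\<theta> X = X"
  shows "\<theta> (g X) = g X"
proof -
  obtain h where h: "h \<in> K" "g o\<^sub>L h = id_blinfun" "h o\<^sub>L g = id_blinfun"
    using K_inverse[OF g] by metis
  have "blinfun_exp (t *\<^sub>R ad br (g X)) \<in> K" for t
  proof -
    have "t *\<^sub>R ad br (g X) = g o\<^sub>L (t *\<^sub>R ad br X) o\<^sub>L h"
      unfolding ad_automorphism[OF K_lie_aut[OF g] h(2), symmetric]
      by (intro blinfun_eqI) (simp add: blinfun.bilinear_simps)
    then have "blinfun_exp (t *\<^sub>R ad br (g X)) = g o\<^sub>L blinfun_exp (t *\<^sub>R ad br X) o\<^sub>L h"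
      by (simp add: blinfun_exp_conjugate[OF h(2,3)])
    then show ?thesis
      using K_compose blinfun_exp_scaled_mem_K[OF X] g h(1) by metis
  qed
  then have "ad br (g X) \<in> ad br ` {X. \<theta> X = X}"
    unfolding lie_algebra_of_K[symmetric] by (simp add: lie_algebra_of_def)
  then show ?thesis using ad_inj by blast
qed

text \<open>The \<open>-1\<close>-eigenspace of \<open>\<theta>\<close> is preserved as well, because it is the orthogonal
  complement of the fixed space for the Killing form.\<close>

lemma K_theta:
  assumes g: "g \<in> K"
  shows "\<theta> (g X) = g (\<theta> X)"
proof -
  obtain h where h: "h \<in> K" "\<And>X. g (blinfun_apply h X) = X"
    using K_inverse[OF g] by metis
  have anti: "\<theta> (g V) = - g V" if V: "\<theta> V = - V" for V
  proof -
    \<comment> \<open>Twice the fixed part of \<open>g V\<close>. It turns out isotropic for the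
      Killing form, which is definite on fixed vectors.\<close>
    define W where "W = g V + \<theta> (g V)"
    have W: "\<theta> W = W" by (simp add: W_def linear_add[OF linear_theta] add.commute)
    have "killing br V (h W) = 0"
      using killing_theta[of V "h W"] K_preserves_fixed[OF h(1) W] V
      by (simp add: linear_neg[OF linear_killing_left])
    then have "killing br (g V) W = 0"
      using killing_lie_aut[OF K_lie_aut[OF g], of V "h W"] by (simp add: h)
    moreover have "killing br (\<theta> (g V)) W = killing br (g V) W"
      using killing_theta[of "g V" W] by (simp add: W)
    ultimately have "killing br W W = 0"
      by (simp add: W_def linear_add[OF linear_killing_left])
    then have "W = 0"
      using ip_self_eq_0_iff[of W] by (simp add: ip_def W)
    then show ?thesis by (simp add: W_def eq_neg_iff_add_eq_0 add.commute)
  qed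
  obtain U V where "X = U + V" "\<theta> U = U" "\<theta> V = - V" by (rule theta_decomposition)
  then show ?thesis
    using K_preserves_fixed[OF g, of U] anti[of V]
    by (simp add: blinfun.bilinear_simps linear_add[OF linear_theta])
qed

text \<open>\<open>K\<close> acts by isometries of \<open>ip\<close>, and \<open>ip\<close> is
  comparable with the square of the norm.\<close>

lemma bounded_K: "bounded K"
proof -
  obtain c where c: "c > 0" "\<And>X. c * (norm X)\<^sup>2 \<le> ip X X" using ip_ge_norm by blast
  obtain b where b: "b > 0" "\<And>X Y. norm (ip X Y) \<le> norm X * norm Y * b"
    using ip.pos_bounded by blast
  have "norm g \<le> sqrt (b / c)" if g: "g \<in> K" for g
  proof (rule norm_blinfun_bound)
    fix X
    have "c * (norm (g X))\<^sup>2 \<le> b * (norm X)\<^sup>2"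
      using c(2)[of "g X"] b(2)[of X X] ip_lie_aut[OF K_lie_aut[OF g] K_theta[OF g], of X X]
      by (simp add: power2_eq_square mult.commute)
    then have "(norm (g X))\<^sup>2 \<le> b / c * (norm X)\<^sup>2" using c(1) by (simp add: field_simps)
    then have "sqrt ((norm (g X))\<^sup>2) \<le> sqrt (b / c * (norm X)\<^sup>2)" by (rule real_sqrt_le_mono)
    then show "norm (g X) \<le> sqrt (b / c) * norm X"
      unfolding real_sqrt_mult by simp
  qed (use b c in simp)
  then show ?thesis by (auto simp: bounded_iff)
qed

text \<open>The limit \<open>l\<close> is again an automorphism commuting with
  \<open>\<theta>\<close>. For large \<open>n\<close> the quotient of \<open>x n\<close> by
  \<open>l\<close> is near the identity, hence the exponential of a fixed vector and so in
  \<open>K\<close>; therefore \<open>l\<close> is in \<open>K\<close> as well.\<close>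

lemma closed_K: "closed K"
proof (unfold closed_sequential_limits, intro allI impI, elim conjE)
  fix x :: "nat \<Rightarrow> 'a \<Rightarrow>\<^sub>L 'a" and l
  assume x: "\<forall>n. x n \<in> K" and lim: "x \<longlonglongrightarrow> l"
  have l: "(\<lambda>n. x n X) \<longlonglongrightarrow> l X" for X
    by (intro tendsto_intros lim)
  have hom: "l (br X Y) = br (l X) (l Y)" for X Y
  proof (rule LIMSEQ_unique[OF l])
    have "x n (br X Y) = br (x n X) (x n Y)" for n
      using x K_lie_aut lie_autD(2) by blast
    then show "(\<lambda>n. x n (br X Y)) \<longlonglongrightarrow> br (l X) (l Y)"
      by (simp add: br.tendsto l)
  qed
  have th: "\<theta> (l X) = l (\<theta> X)" for X
  proof (rule LIMSEQ_unique[OF _ l])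
    show "(\<lambda>n. x n (\<theta> X)) \<longlonglongrightarrow> \<theta> (l X)"
      using bounded_linear.tendsto[OF bounded_linear_theta l[of X]] x K_theta by simp
  qed
  \<comment> \<open>Bijectivity alone can be lost in a limit; the isometry property survives and
    makes \<open>l\<close> injective.\<close>
  have "ip (l X) (l X) = ip X X" for X
  proof (rule LIMSEQ_unique)
    show "(\<lambda>n. ip (x n X) (x n X)) \<longlonglongrightarrow> ip (l X) (l X)"
      by (intro ip.tendsto l)
    have "ip (x n X) (x n X) = ip X X" for n
      using x ip_lie_aut K_lie_aut K_theta by blast
    then show "(\<lambda>n. ip (x n X) (x n X)) \<longlonglongrightarrow> ip X X" by simp
  qed
  then have "X = 0" if "l X = 0" for X
    using that ip_self_eq_0_iff[of X] by (metis ip.zero_left)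
  moreover have lin: "linear (blinfun_apply l)"
    by (simp add: bounded_linear.linear blinfun.bounded_linear_right)
  ultimately have "inj (blinfun_apply l)"
    by (auto simp: linear_injective_0)
  with lin have "bij (blinfun_apply l)"
    by (simp add: bij_def linear_injective_imp_surjective)
  then have laut: "l \<in> lie_aut br" by (simp add: lie_aut_def hom)
  then obtain l' where l': "l' \<in> lie_aut br" "l o\<^sub>L l' = id_blinfun" "l' o\<^sub>L l = id_blinfun"
    "\<And>X. l (blinfun_apply l' X) = X" "\<And>X. l' (blinfun_apply l X) = X"
    using lie_aut_inverse by metis
  obtain \<epsilon> where \<epsilon>: "\<epsilon> > 0" "\<And>g. g \<in> lie_aut br \<Longrightarrow> norm (g - id_blinfun) < \<epsilon> \<Longrightarrow>
    (\<And>X. \<theta> (blinfun_apply g X) = g (\<theta> X)) \<Longrightarrow> \<exists>X. \<theta> X = X \<and> g = blinfun_exp (ad br X)"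
    using theta_commuting_lie_aut_near_id by blast
  have "(\<lambda>n. l' o\<^sub>L x n) \<longlonglongrightarrow> (l' o\<^sub>L l)"
    by (intro tendsto_intros lim)
  from LIMSEQ_D[OF this \<epsilon>(1)] obtain n where "norm ((l' o\<^sub>L x n) - (l' o\<^sub>L l)) < \<epsilon>"
    by (meson order_refl)
  then have "norm ((l' o\<^sub>L x n) - id_blinfun) < \<epsilon>"
    by (simp only: l'(3))
  moreover have "\<theta> ((l' o\<^sub>L x n) X) = (l' o\<^sub>L x n) (\<theta> X)" for X
  proof -
    have "\<theta> (l' Y) = l' (\<theta> Y)" for Y
      using th[of "l' Y"] l'(5)[of "\<theta> (l' Y)"] by (simp add: l')
    then show ?thesis using x K_theta by simp
  qed
  moreover have "l' o\<^sub>L x n \<in> lie_aut br"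
    using x K_lie_aut l'(1) compose_mem_lie_aut by blast
  ultimately obtain X where X: "\<theta> X = X" "l' o\<^sub>L x n = blinfun_exp (ad br X)"
    using \<epsilon>(2) by blast
  have "l (blinfun_exp (ad br X) Y) = x n Y" for Y
    using X(2)[symmetric] by (simp add: l')
  then have "l = x n o\<^sub>L blinfun_exp (- ad br X)"
    by (intro blinfun_eqI) (metis blinfun_apply_blinfun_compose blinfun_exp_apply_inverse(1))
  also have "- ad br X = ad br (- X)" by (simp add: linear_neg[OF linear_ad])
  finally show "l \<in> K"
    using x X(1) blinfun_exp_mem_K[of "- X"] by (simp add: K_compose linear_neg[OF linear_theta])
qed

lemma compact_K: "compact K"
  using bounded_K closed_K by (simp add: compact_eq_bounded_closed)

end

section \<open>Restricted root spaces\<close>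

text \<open>First-order condition for a minimum at \<open>t = 0\<close>. The test value
  \<open>t = - s * a\<close> gives \<open>(s * a\<^sup>2) * (s * b - 2)\<close>, which is negative
  unless \<open>a = 0\<close> since \<open>s * b\<close> is at most 1.\<close>

lemma linear_term_eq_0:
  fixes a b :: real
  assumes "\<And>t. 2 * t * a + t\<^sup>2 * b \<ge> 0" "b \<ge> 0"
  shows "a = 0"
proof -
  define s where "s = 1 / (b + 1)"
  have s: "s > 0" "s * b \<le> 1" using assms(2) by (auto simp: s_def field_simps)
  have "0 \<le> 2 * (- s * a) * a + (- s * a)\<^sup>2 * b" by (rule assms(1))
  also have "\<dots> = (s * a\<^sup>2) * (s * b - 2)" by (simp add: power2_eq_square algebra_simps)
  finally have "s * a\<^sup>2 \<le> 0" using s(2) by (simp add: zero_le_mult_iff)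
  then show ?thesis using s(1) by (simp add: mult_le_0_iff)
qed

context cartan_lie_algebra
begin

text \<open>The maximum of the Rayleigh quotient over the unit sphere of \<open>V\<close> is an eigenvalue.\<close>

lemma symmetric_has_eigenvector:
  assumes V: "subspace V" "V \<noteq> {0}" and T: "linear T" "\<And>v. v \<in> V \<Longrightarrow> T v \<in> V"
    and sym: "\<And>v w. ip (T v) w = ip v (T w)"
  obtains x c where "x \<in> V" "x \<noteq> 0" "T x = c *\<^sub>R x"
proof -
  let ?S = "sphere 0 1 \<inter> V"
  have "compact ?S"
    using closed_subspace[OF V(1)] by (intro compact_Int_closed) auto
  moreover obtain v where "v \<in> V" "v \<noteq> 0" using V(2) subspace_0[OF V(1)] by auto
  then have "v /\<^sub>R norm v \<in> ?S" using V(1) by (simp add: subspace_scale)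
  then have "?S \<noteq> {}" by blast
  moreover have "continuous_on ?S (\<lambda>v. ip (T v) v / ip v v)"
  proof (intro continuous_on_divide ip.continuous_on continuous_on_id)
    show "continuous_on ?S T"
      using T(1) by (simp add: linear_continuous_on linear_conv_bounded_linear)
  qed (auto simp: ip_self_eq_0_iff)
  ultimately obtain x where x: "x \<in> ?S" "\<And>y. y \<in> ?S \<Longrightarrow> ip (T y) y / ip y y \<le> ip (T x) x / ip x x"
    using continuous_attains_sup[of ?S "\<lambda>v. ip (T v) v / ip v v"] by metis
  define c where "c = ip (T x) x / ip x x"
  have x0: "x \<noteq> 0" "x \<in> V" using x(1) by auto
  define q where "q v w = c * ip v w - ip (T v) w" for v w
  have q0: "q v v \<ge> 0" if "v \<in> V" for v
  proof (cases "v = 0")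
    case False
    have "ip (T (v /\<^sub>R norm v)) (v /\<^sub>R norm v) / ip (v /\<^sub>R norm v) (v /\<^sub>R norm v) \<le> c"
      unfolding c_def using that V(1) False by (intro x) (simp add: subspace_scale)
    then have "ip (T v) v / ip v v \<le> c"
      using False by (simp add: linear_scale[OF T(1)] ip.scaleR_left ip.scaleR_right)
    then show ?thesis using ip_pos[OF False] by (simp add: q_def field_simps)
  qed (simp add: q_def ip.zero_left ip.zero_right)
  have qx: "q x x = 0" using ip_pos[OF x0(1)] by (simp add: q_def c_def)
  \<comment> \<open>Since \<open>q x w = ip z w\<close>, the vector \<open>z\<close> is both the
    defect of the eigenvalue equation and the direction of variation: a semidefinite form vanishing
    at \<open>x\<close> pairs \<open>x\<close> to 0 with \<open>z\<close>.\<close>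
  define z where "z = c *\<^sub>R x - T x"
  have z: "z \<in> V" using x0 V T by (simp add: z_def subspace_diff subspace_scale)
  have "2 * t * q x z + t\<^sup>2 * q z z \<ge> 0" for t
  proof -
    have "q (x + t *\<^sub>R z) (x + t *\<^sub>R z) = q x x + 2 * t * q x z + t\<^sup>2 * q z z"
      using sym[of x z] ip_sym[of x z] ip_sym[of x "T z"]
      by (simp add: q_def linear_add[OF T(1)] linear_scale[OF T(1)] ip.add_left ip.add_right
          ip.scaleR_left ip.scaleR_right power2_eq_square algebra_simps)
    moreover have "q (x + t *\<^sub>R z) (x + t *\<^sub>R z) \<ge> 0"
      using x0 z V by (intro q0) (simp add: subspace_add subspace_scale)
    ultimately show ?thesis using qx by simp
  qed
  then have "q x z = 0" using q0[OF z] by (rule linear_term_eq_0)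
  moreover have "q x z = ip z z"
    unfolding q_def by (simp add: z_def ip.diff_left ip.scaleR_left)
  ultimately have "z = 0" using ip_self_eq_0_iff by simp
  then show ?thesis using x0 by (intro that[of x c]) (simp_all add: z_def)
qed

end

locale cartan_abelian = cartan_lie_algebra +
  fixes \<aa> :: "'a set"
  assumes abelian: "abelian_subspace br \<aa>" and antifixed: "A \<in> \<aa> \<Longrightarrow> \<theta> A = - A"
begin

lemma subspace_a: "subspace \<aa>"
  using abelian by (simp add: abelian_subspace_def)

lemma br_symmetric:
  assumes "A \<in> \<aa>"
  shows "ip (br A X) Y = ip X (br A Y)"
proof -
  have "br A (\<theta> Y) = - \<theta> (br A Y)"
    using theta_br[of A Y] antifixed[OF assms] by (simp add: br.minus_left)
  then show ?thesis
    by (simp add: ip_def killing_invariant linear_neg[OF linear_killing_right])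
qed

lemma br_commute: "A \<in> \<aa> \<Longrightarrow> B \<in> \<aa> \<Longrightarrow> br A (br B X) = br B (br A X)"
  using abelian jacobi[of A B X] by (simp add: abelian_subspace_def br.zero_left)

text \<open>If every \<open>A\<close> acts on \<open>V\<close> as a scalar, any nonzero vector
  serves. Otherwise an eigenspace of a non-scalar \<open>A\<close> is a smaller subspace, invariant
  because the maps commute.\<close>

lemma joint_eigenvector:
  assumes "subspace V" "V \<noteq> {0}" "\<And>A v. A \<in> \<aa> \<Longrightarrow> v \<in> V \<Longrightarrow> br A v \<in> V"
  shows "\<exists>x\<in>V. x \<noteq> 0 \<and> (\<forall>A\<in>\<aa>. \<exists>c. br A x = c *\<^sub>R x)"
  using assms
proof (induction "dim V" arbitrary: V rule: less_induct)
  case less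
  show ?case
  proof (cases "\<forall>A\<in>\<aa>. \<exists>c. \<forall>x\<in>V. br A x = c *\<^sub>R x")
    case True
    obtain x where "x \<in> V" "x \<noteq> 0" using less.prems(2) subspace_0[OF less.prems(1)] by auto
    then show ?thesis using True by blast
  next
    case False
    then obtain A where A: "A \<in> \<aa>" "\<And>c. \<exists>x\<in>V. br A x \<noteq> c *\<^sub>R x" by blast
    obtain x c where x: "x \<in> V" "x \<noteq> 0" "br A x = c *\<^sub>R x"
      using symmetric_has_eigenvector[OF less.prems(1,2) linear_br, of A] less.prems(3) A(1)
        br_symmetric by metis
    define W where "W = {v \<in> V. br A v = c *\<^sub>R v}"
    have W: "subspace W"
      using less.prems(1)
      by (auto simp: W_def subspace_def br.add_right br.scaleR_right br.zero_right scaleR_add_right)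
    have "W \<subset> V" using A(2)[of c] by (auto simp: W_def)
    then have "dim W < dim V"
      using W less.prems(1) by (intro dim_psubset) (simp add: span_eq_iff[THEN iffD2])
    moreover have "W \<noteq> {0}" using x by (auto simp: W_def)
    moreover have "br B v \<in> W" if "B \<in> \<aa>" "v \<in> W" for B v
      using that A(1) less.prems(3) br_commute[of A B v]
      by (auto simp: W_def br.scaleR_right)
    ultimately have "\<exists>x\<in>W. x \<noteq> 0 \<and> (\<forall>A\<in>\<aa>. \<exists>c. br A x = c *\<^sub>R x)"
      using less.hyps[of W] W by blast
    then show ?thesis by (auto simp: W_def)
  qed
qed

lemma joint_eigenvector_mem_root_space:
  assumes x: "x \<noteq> 0" "\<forall>A\<in>\<aa>. \<exists>c. br A x = c *\<^sub>R x"
  shows "\<exists>\<alpha>\<in>dual_of \<aa>. x \<in> root_space br \<aa> \<alpha>"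
proof
  \<comment> \<open>Writing the eigenvalue as a quotient makes its linearity in \<open>A\<close>
    visible; \<open>restrict\<close> makes it extensional, as \<open>dual_of\<close>
    demands.\<close>
  define \<alpha> where "\<alpha> = restrict (\<lambda>A. ip (br A x) x / ip x x) \<aa>"
  show "\<alpha> \<in> dual_of \<aa>"
    using subspace_a
    by (auto simp: \<alpha>_def dual_of_def br.add_left br.scaleR_left ip.add_left ip.scaleR_left
        add_divide_distrib subspace_add subspace_scale)
  show "x \<in> root_space br \<aa> \<alpha>"
    using x(2) ip_pos[OF x(1)] by (force simp: \<alpha>_def root_space_def ip.scaleR_left)
qed

text \<open>Otherwise the \<open>ip\<close>-complement of the sum is a nonzero invariant subspace,
  since each \<open>br A\<close> is symmetric. Its joint eigenvector lies in a root space and is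
  orthogonal to itself. The zero functional is among the indices and contributes the centralizer of
  \<open>\<aa>\<close>.\<close>

lemma span_root_spaces: "span (\<Union>\<alpha>\<in>dual_of \<aa>. root_space br \<aa> \<alpha>) = UNIV"
proof (rule ccontr)
  let ?W = "span (\<Union>\<alpha>\<in>dual_of \<aa>. root_space br \<aa> \<alpha>)"
  define V where "V = {v. \<forall>w\<in>?W. ip v w = 0}"
  assume "?W \<noteq> UNIV"
  \<comment> \<open>This normal vector belongs to the inner product of the type; the Killing form
    converts it into the \<open>ip\<close>-normal vector \<open>\<theta> Z\<close>.\<close>
  then obtain u where u: "u \<noteq> 0" "\<And>w. w \<in> ?W \<Longrightarrow> u \<bullet> w = 0"
    using span_not_UNIV_orthogonal by metis
  obtain Z where Z: "\<And>X. u \<bullet> X = killing br Z X"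
    using functional_eq_killing[of "\<lambda>X. u \<bullet> X"]
    by (auto simp: bounded_linear.linear bounded_linear_inner_right)
  have "ip (\<theta> Z) w = - (u \<bullet> w)" for w
    using killing_theta[of Z w] by (simp add: ip_def Z)
  then have "\<theta> Z \<in> V" using u(2) by (simp add: V_def)
  moreover have "\<theta> Z \<noteq> 0"
  proof
    assume "\<theta> Z = 0"
    then have "Z = 0" using theta_theta[of Z] by (simp add: linear_0[OF linear_theta])
    then show False using Z[of u] u(1) by (simp add: linear_0[OF linear_killing_left])
  qed
  moreover have V: "subspace V"
    by (auto simp: V_def subspace_def ip.add_left ip.scaleR_left ip.zero_left)
  moreover have "br A v \<in> V" if A: "A \<in> \<aa>" and v: "v \<in> V" for A v
  proof -
    have "br A w \<in> ?W" if "w \<in> ?W" for w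
      using that
    proof (induction rule: span_induct)
      case base
      show ?case
        by (auto simp: subspace_def br.zero_right br.add_right br.scaleR_right
            span_zero span_add span_scale)
    next
      case (step w)
      then obtain \<alpha> where "\<alpha> \<in> dual_of \<aa>" "w \<in> root_space br \<aa> \<alpha>" by blast
      moreover from this have "br A w = \<alpha> A *\<^sub>R w" using A by (simp add: root_space_def)
      ultimately show ?case by (auto intro: span_scale span_base)
    qed
    then show ?thesis using v by (simp add: V_def br_symmetric[OF A])
  qed
  ultimately obtain x where x: "x \<in> V" "x \<noteq> 0" "\<forall>A\<in>\<aa>. \<exists>c. br A x = c *\<^sub>R x"
    using joint_eigenvector[of V] by blast
  then have "x \<in> ?W"
    using joint_eigenvector_mem_root_space[OF x(2,3)] by (auto intro: span_base)
  then show False using x(1,2) ip_self_eq_0_iff by (auto simp: V_def)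
qed

lemma br_root_spaces:
  assumes "\<alpha> \<in> dual_of \<aa>" "\<beta> \<in> dual_of \<aa>" "x \<in> root_space br \<aa> \<alpha>" "y \<in> root_space br \<aa> \<beta>"
  shows "restrict (\<lambda>A. \<alpha> A + \<beta> A) \<aa> \<in> dual_of \<aa>"
    and "br x y \<in> root_space br \<aa> (restrict (\<lambda>A. \<alpha> A + \<beta> A) \<aa>)"
  using assms subspace_a
  by (auto simp: dual_of_def subspace_add subspace_scale algebra_simps)
    (auto simp: root_space_def jacobi[of _ x y] br.scaleR_left br.scaleR_right scaleR_add_left)

lemma theta_root_space:
  assumes "\<alpha> \<in> dual_of \<aa>" "x \<in> root_space br \<aa> \<alpha>"
  shows "restrict (\<lambda>A. - \<alpha> A) \<aa> \<in> dual_of \<aa>"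
    and "\<theta> x \<in> root_space br \<aa> (restrict (\<lambda>A. - \<alpha> A) \<aa>)"
proof -
  show "restrict (\<lambda>A. - \<alpha> A) \<aa> \<in> dual_of \<aa>"
    using assms subspace_a by (auto simp: dual_of_def subspace_add subspace_scale)
  have "br A (\<theta> x) = - (\<alpha> A *\<^sub>R \<theta> x)" if "A \<in> \<aa>" for A
    using theta_br[of A x] antifixed[OF that] assms(2) that
    by (simp add: root_space_def br.minus_left linear_scale[OF linear_theta])
  then show "\<theta> x \<in> root_space br \<aa> (restrict (\<lambda>A. - \<alpha> A) \<aa>)"
    by (simp add: root_space_def)
qed

end

section \<open>The nilpotent part of an element of \<open>\<aa>\<close>\<close>

locale cartan_element = cartan_abelian +
  fixes H :: 'a
  assumes H: "H \<in> \<aa>"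
begin

text \<open>The sum of the eigenspaces of \<open>br H\<close> with eigenvalue at least
  \<open>c\<close>: a filtration for which the bracket adds the thresholds.\<close>

definition n_ge :: "real \<Rightarrow> 'a set" where
  "n_ge c = span (\<Union>\<alpha>\<in>{\<alpha> \<in> dual_of \<aa>. \<alpha> H \<ge> c}. root_space br \<aa> \<alpha>)"

lemma mem_n_ge: "\<alpha> \<in> dual_of \<aa> \<Longrightarrow> \<alpha> H \<ge> c \<Longrightarrow> x \<in> root_space br \<aa> \<alpha> \<Longrightarrow> x \<in> n_ge c"
  by (auto simp: n_ge_def intro: span_base)

lemma subspace_n_ge: "subspace (n_ge c)"
  by (simp add: n_ge_def)

lemma n_ge_antimono: "c \<le> d \<Longrightarrow> n_ge d \<subseteq> n_ge c"
  unfolding n_ge_def by (intro span_mono) auto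

lemma n_ge_induct [consumes 1, case_names subspace root_space]:
  assumes "x \<in> n_ge c" "subspace (Collect P)"
    "\<And>\<alpha> x. \<alpha> \<in> dual_of \<aa> \<Longrightarrow> \<alpha> H \<ge> c \<Longrightarrow> x \<in> root_space br \<aa> \<alpha> \<Longrightarrow> P x"
  shows "P x"
  using span_induct[OF assms(1)[unfolded n_ge_def] assms(2)] assms(3) by auto

lemma br_n_ge:
  assumes x: "x \<in> n_ge c" and y: "y \<in> n_ge d"
  shows "br x y \<in> n_ge (c + d)"
  using x
proof (induction rule: n_ge_induct)
  case subspace
  show ?case using subspace_n_ge[of "c + d"]
    by (auto simp: subspace_def br.zero_left br.add_left br.scaleR_left)
next
  case (root_space \<alpha> x)
  note \<alpha> = this
  show ?case using y
  proof (induction rule: n_ge_induct)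
    case subspace
    show ?case using subspace_n_ge[of "c + d"]
      by (auto simp: subspace_def br.zero_right br.add_right br.scaleR_right)
  next
    case (root_space \<beta> y)
    then show ?case
      using \<alpha> H br_root_spaces[of \<alpha> \<beta> x y] by (intro mem_n_ge) auto
  qed
qed

lemma H_surj_n_ge:
  assumes "c > 0" "y \<in> n_ge c"
  shows "\<exists>x\<in>n_ge c. br H x = y"
  using assms(2)
proof (induction rule: n_ge_induct)
  case subspace
  show ?case
    unfolding subspace_def mem_Collect_eq
  proof (intro conjI allI ballI impI)
    show "\<exists>x\<in>n_ge c. br H x = 0"
      using subspace_0[OF subspace_n_ge] br.zero_right by blast
    show "\<exists>x\<in>n_ge c. br H x = y + z"
      if "y \<in> Collect (\<lambda>y. \<exists>x\<in>n_ge c. br H x = y)" "z \<in> Collect (\<lambda>y. \<exists>x\<in>n_ge c. br H x = y)" for y z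
      using that subspace_add[OF subspace_n_ge] br.add_right by fastforce
    show "\<exists>x\<in>n_ge c. br H x = a *\<^sub>R y"
      if "y \<in> Collect (\<lambda>y. \<exists>x\<in>n_ge c. br H x = y)" for a y
      using that subspace_scale[OF subspace_n_ge] br.scaleR_right by fastforce
  qed
next
  case (root_space \<alpha> y)
  then have "y /\<^sub>R \<alpha> H \<in> n_ge c"
    by (intro subspace_scale[OF subspace_n_ge] mem_n_ge)
  moreover have "br H (y /\<^sub>R \<alpha> H) = y"
    using root_space H assms(1) by (simp add: root_space_def br.scaleR_right)
  ultimately show ?case by blast
qed

text \<open>No eigenvalue of \<open>ad br H\<close> exceeds its operator norm. This ends the
  iteration that doubles the threshold.\<close>

lemma n_ge_large: "n_ge (norm (ad br H) + 1) = {0}"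
proof -
  have "x = 0" if "x \<in> n_ge (norm (ad br H) + 1)" for x
    using that
  proof (induction rule: n_ge_induct)
    case (root_space \<alpha> x)
    have "\<bar>\<alpha> H\<bar> * norm x \<le> norm (ad br H) * norm x"
      using norm_blinfun[of "ad br H" x] root_space(3) H by (simp add: root_space_def)
    moreover have "(norm (ad br H) + 1) * norm x \<le> \<bar>\<alpha> H\<bar> * norm x"
      using root_space(2) by (intro mult_right_mono) auto
    ultimately have "norm x \<le> 0" unfolding distrib_right by linarith
    then show ?case by simp
  qed (simp add: subspace_def)
  then show ?thesis using subspace_0[OF subspace_n_ge] by blast
qed

abbreviation \<nn> :: "'a set" where
  "\<nn> \<equiv> n_plus br \<aa> H"

lemma subspace_n: "subspace \<nn>"
  by (simp add: n_plus_def)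

lemma mem_n:
  assumes "\<alpha> \<in> dual_of \<aa>" "\<alpha> H > 0" "x \<in> root_space br \<aa> \<alpha>"
  shows "x \<in> \<nn>"
proof (cases "x = 0")
  case False
  then have "\<alpha> \<in> roots br \<aa>" using assms H by (force simp: roots_def)
  then show ?thesis using assms by (auto simp: n_plus_def intro: span_base)
qed (simp add: n_plus_def span_zero)

lemma n_induct [consumes 1, case_names subspace root_space]:
  assumes "x \<in> \<nn>" "subspace (Collect P)"
    "\<And>\<alpha> x. \<alpha> \<in> dual_of \<aa> \<Longrightarrow> \<alpha> H > 0 \<Longrightarrow> x \<in> root_space br \<aa> \<alpha> \<Longrightarrow> P x"
  shows "P x"
  using span_induct[OF assms(1)[unfolded n_plus_def] assms(2)] assms(3) by (auto simp: roots_def)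

text \<open>A given element is a sum of finitely many root vectors, so the least eigenvalue involved
  is positive. Thresholds are halved here to match the doubling in the iteration.\<close>

lemma mem_n_ge_of_mem_n:
  assumes "x \<in> \<nn>" "C > 0"
  shows "\<exists>m. x \<in> n_ge (C / 2 ^ m)"
  using assms(1)
proof (induction rule: n_induct)
  case subspace
  have mono: "n_ge (C / 2 ^ m) \<subseteq> n_ge (C / 2 ^ n)" if "m \<le> n" for m n
    using that assms(2) by (intro n_ge_antimono divide_left_mono power_increasing) auto
  show ?case
    unfolding subspace_def mem_Collect_eq
  proof (intro conjI allI ballI impI)
    show "\<exists>m. 0 \<in> n_ge (C / 2 ^ m)" using subspace_0[OF subspace_n_ge] by blast
    show "\<exists>m. x + y \<in> n_ge (C / 2 ^ m)"
      if xy: "x \<in> Collect (\<lambda>x. \<exists>m. x \<in> n_ge (C / 2 ^ m))" "y \<in> Collect (\<lambda>x. \<exists>m. x \<in> n_ge (C / 2 ^ m))" for x y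
    proof -
      obtain m n where "x \<in> n_ge (C / 2 ^ m)" "y \<in> n_ge (C / 2 ^ n)" using xy by blast
      then have "x \<in> n_ge (C / 2 ^ max m n)" "y \<in> n_ge (C / 2 ^ max m n)"
        using mono[of m "max m n"] mono[of n "max m n"] by auto
      then show ?thesis using subspace_add[OF subspace_n_ge] by blast
    qed
    show "\<exists>m. a *\<^sub>R x \<in> n_ge (C / 2 ^ m)"
      if "x \<in> Collect (\<lambda>x. \<exists>m. x \<in> n_ge (C / 2 ^ m))" for a x
      using that subspace_scale[OF subspace_n_ge] by blast
  qed
next
  case (root_space \<alpha> x)
  obtain m where "C / \<alpha> H < 2 ^ m" using real_arch_pow[of 2 "C / \<alpha> H"] by auto
  then have "C / 2 ^ m \<le> \<alpha> H" using root_space(2) by (simp add: field_simps)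
  then show ?case using mem_n_ge root_space by blast
qed

text \<open>If \<open>[H, X] = Y\<close>, then \<open>exp (ad X)\<close> cancels \<open>Y\<close> in \<open>H + Y\<close> up to terms
  on which \<open>ad H\<close> has at least twice the eigenvalues. As the eigenvalues are bounded, finitely
  many such steps lead from \<open>H + Y\<close> to \<open>H\<close>.\<close>

lemma H_plus_n_ge_subset_orbit:
  "Y \<in> n_ge ((norm (ad br H) + 1) / 2 ^ m) \<Longrightarrow> \<exists>g\<in>lie_aut0 br. H + Y = g H"
proof (induction m arbitrary: Y)
  case 0
  then have "Y = 0" using n_ge_large by auto
  then show ?case using id_mem_lie_aut0 by force
next
  case (Suc m)
  \<comment> \<open>Half the threshold of the induction hypothesis, so that the error, which lies in
    \<open>n_ge (c + c)\<close>, falls under that hypothesis.\<close>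
  define c where "c = (norm (ad br H) + 1) / 2 ^ Suc m"
  have c: "c > 0" by (simp add: c_def add_nonneg_pos)
  have Y: "Y \<in> n_ge c" using Suc.prems by (simp add: c_def)
  have c2: "c + c = (norm (ad br H) + 1) / 2 ^ m" by (simp add: c_def)
  obtain X where X: "X \<in> n_ge c" "br H X = Y" using H_surj_n_ge[OF c Y] by blast
  define D where "D = ad br X"
  define V where "V = n_ge (c + c)"
  have V: "subspace V" by (simp add: V_def subspace_n_ge)
  have DV: "D v \<in> V" if "v \<in> V" for v
    using br_n_ge[OF X(1), of v "c + c"] that n_ge_antimono[of "c + c" "c + (c + c)"] c
    by (auto simp: V_def D_def)
  have DH: "D H = - Y" using X(2) br_antisym[of X H] by (simp add: D_def)
  have DY: "D Y \<in> V" using br_n_ge[OF X(1) Y] by (simp add: D_def V_def)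
  have "blinfun_exp D H - H - D H \<in> V"
  proof (rule blinfun_exp_minus_linear_mem[OF V DV])
    show "D (D H) \<in> V" using DY subspace_neg[OF V] by (simp add: DH blinfun.minus_right)
  qed
  moreover have "blinfun_exp D Y - Y \<in> V"
    by (rule blinfun_exp_minus_id_mem[OF V DV DY])
  ultimately have "(blinfun_exp D H - H - D H) + (blinfun_exp D Y - Y) \<in> V"
    by (rule subspace_add[OF V])
  then have "blinfun_exp D (H + Y) - H \<in> V"
    by (simp add: DH blinfun.add_right algebra_simps)
  then obtain g where g: "g \<in> lie_aut0 br" "H + (blinfun_exp D (H + Y) - H) = g H"
    using Suc.IH[of "blinfun_exp D (H + Y) - H"] by (auto simp: V_def c2)
  have "H + Y = blinfun_exp (ad br (- X)) (g H)"
    using g(2) blinfun_exp_apply_inverse(2)[of D "H + Y"]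
    by (simp add: D_def linear_neg[OF linear_ad])
  then have "H + Y = (blinfun_exp (ad br (- X)) o\<^sub>L g) H" by simp
  then show ?case
    using compose_mem_lie_aut0[OF blinfun_exp_ad_mem_lie_aut0 g(1)] by blast
qed

lemma H_plus_n_subset_orbit:
  assumes "Y \<in> \<nn>"
  obtains g where "g \<in> lie_aut0 br" "H + Y = g H"
proof -
  have "norm (ad br H) + 1 > 0" by (simp add: add_nonneg_pos)
  then show ?thesis
    using mem_n_ge_of_mem_n[OF assms] H_plus_n_ge_subset_orbit that by blast
qed

text \<open>The condition says that \<open>br X\<close> maps the affine space
  \<open>H + \<nn>\<close> into its direction \<open>\<nn>\<close>, which is what makes
  \<open>blinfun_exp (ad br X)\<close> preserve that space.\<close>

definition \<pp> :: "'a set" where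
  "\<pp> = {X. br X H \<in> \<nn> \<and> (\<forall>Y\<in>\<nn>. br X Y \<in> \<nn>)}"

lemma subspace_p: "subspace \<pp>"
  using subspace_n by (auto simp: subspace_def \<pp>_def br.zero_left br.add_left br.scaleR_left)

lemma mem_p:
  assumes \<alpha>: "\<alpha> \<in> dual_of \<aa>" "\<alpha> H \<ge> 0" "x \<in> root_space br \<aa> \<alpha>"
  shows "x \<in> \<pp>"
proof -
  have "br x H = - \<alpha> H *\<^sub>R x"
    using br_antisym[of x H] \<alpha>(3) H by (simp add: root_space_def)
  then have "br x H \<in> \<nn>"
    using \<alpha> mem_n[OF \<alpha>(1) _ \<alpha>(3)] subspace_scale[OF subspace_n, of x "- \<alpha> H"] subspace_0[OF subspace_n]
    by (cases "\<alpha> H = 0") auto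
  moreover have "br x Y \<in> \<nn>" if "Y \<in> \<nn>" for Y
    using that
  proof (induction rule: n_induct)
    case subspace
    show ?case using subspace_n
      by (auto simp: subspace_def br.zero_right br.add_right br.scaleR_right)
  next
    case (root_space \<beta> y)
    then show ?case
      using \<alpha> H br_root_spaces[of \<alpha> \<beta> x y] by (intro mem_n) auto
  qed
  ultimately show ?thesis by (simp add: \<pp>_def)
qed

text \<open>For a root vector \<open>x\<close> with \<open>\<alpha> H < 0\<close> write
  \<open>x = (x + \<theta> x) - \<theta> x\<close>: the first part is fixed, and
  \<open>\<theta>\<close> moves \<open>x\<close> to the opposite root space, which lies in
  \<open>\<pp>\<close>.\<close>

lemma fixed_plus_p: "\<exists>U. \<theta> U = U \<and> X - U \<in> \<pp>"
proof -
  have "X \<in> span (\<Union>\<alpha>\<in>dual_of \<aa>. root_space br \<aa> \<alpha>)" by (simp add: span_root_spaces)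
  then show ?thesis
  proof (induction rule: span_induct)
    case base
    show ?case
      unfolding subspace_def mem_Collect_eq
    proof (intro conjI allI ballI impI)
      show "\<exists>U. \<theta> U = U \<and> 0 - U \<in> \<pp>"
        using subspace_0[OF subspace_p] by (intro exI[of _ 0]) (simp add: linear_0[OF linear_theta])
      show "\<exists>U. \<theta> U = U \<and> X + Y - U \<in> \<pp>"
        if X: "X \<in> {X. \<exists>U. \<theta> U = U \<and> X - U \<in> \<pp>}" "Y \<in> {X. \<exists>U. \<theta> U = U \<and> X - U \<in> \<pp>}" for X Y
      proof -
        obtain U V where "\<theta> U = U" "X - U \<in> \<pp>" "\<theta> V = V" "Y - V \<in> \<pp>" using X by blast
        then show ?thesis
          using subspace_add[OF subspace_p, of "X - U" "Y - V"]
          by (intro exI[of _ "U + V"]) (simp add: linear_add[OF linear_theta] algebra_simps)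
      qed
      show "\<exists>U. \<theta> U = U \<and> c *\<^sub>R X - U \<in> \<pp>"
        if X: "X \<in> {X. \<exists>U. \<theta> U = U \<and> X - U \<in> \<pp>}" for c X
      proof -
        obtain U where "\<theta> U = U" "X - U \<in> \<pp>" using X by blast
        then show ?thesis
          using subspace_scale[OF subspace_p, of "X - U" c]
          by (intro exI[of _ "c *\<^sub>R U"]) (simp add: linear_scale[OF linear_theta] algebra_simps)
      qed
    qed
  next
    case (step x)
    then obtain \<alpha> where \<alpha>: "\<alpha> \<in> dual_of \<aa>" "x \<in> root_space br \<aa> \<alpha>" by blast
    show ?case
    proof (cases "\<alpha> H \<ge> 0")
      case True
      then show ?thesis
        using mem_p \<alpha> by (intro exI[of _ 0]) (simp add: linear_0[OF linear_theta])
    next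
      case False
      then have "\<theta> x \<in> \<pp>"
        using theta_root_space[OF \<alpha>] H by (intro mem_p) auto
      then have "x - (x + \<theta> x) \<in> \<pp>" using subspace_neg[OF subspace_p] by simp
      then show ?thesis
        by (intro exI[of _ "x + \<theta> x"]) (simp add: linear_add[OF linear_theta] add.commute)
    qed
  qed
qed

text \<open>The decomposition need not be unique, so components are chosen on a basis and extended
  linearly.\<close>

lemma linear_projection_fixed:
  obtains \<kappa> where "linear \<kappa>" "\<And>X. \<theta> (\<kappa> X) = \<kappa> X" "\<And>X. X - \<kappa> X \<in> \<pp>"
proof -
  obtain u where u: "\<And>X. \<theta> (u X) = u X" "\<And>X. X - u X \<in> \<pp>"
    using fixed_plus_p by metis
  define \<kappa> where "\<kappa> X = (\<Sum>b\<in>Basis. (X \<bullet> b) *\<^sub>R u b)" for X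
  have "linear \<kappa>"
    unfolding \<kappa>_def
    by (intro linearI) (simp_all add: inner_add_left scaleR_add_left sum.distrib scaleR_sum_right)
  moreover have "\<theta> (\<kappa> X) = \<kappa> X" for X
    by (simp add: \<kappa>_def linear_sum[OF linear_theta] linear_scale[OF linear_theta] u)
  moreover have "X - \<kappa> X \<in> \<pp>" for X
  proof -
    have "X - \<kappa> X = (\<Sum>b\<in>Basis. (X \<bullet> b) *\<^sub>R b) - \<kappa> X" by (simp add: euclidean_representation)
    also have "\<dots> = (\<Sum>b\<in>Basis. (X \<bullet> b) *\<^sub>R (b - u b))"
      by (simp add: \<kappa>_def scaleR_diff_right sum_subtractf)
    finally show ?thesis
      using u(2) by (simp add: subspace_sum[OF subspace_p] subspace_scale[OF subspace_p])
  qed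
  ultimately show ?thesis using that by blast
qed

lemma blinfun_exp_p:
  assumes P: "P \<in> \<pp>" and y: "y - H \<in> \<nn>"
  shows "blinfun_exp (ad br P) y - H \<in> \<nn>"
proof -
  have "blinfun_exp (ad br P) H - H \<in> \<nn>"
    using P by (intro blinfun_exp_minus_id_mem subspace_n) (auto simp: \<pp>_def)
  moreover have "blinfun_exp (ad br P) (y - H) - (y - H) \<in> \<nn>"
    using P y by (intro blinfun_exp_minus_id_mem subspace_n) (auto simp: \<pp>_def)
  ultimately have "(blinfun_exp (ad br P) H - H) + (blinfun_exp (ad br P) (y - H) - (y - H)) + (y - H) \<in> \<nn>"
    using y by (intro subspace_add[OF subspace_n])
  then show ?thesis by (simp add: blinfun.diff_right)
qed

end

section \<open>The orbit\<close>

lemma adjoint_orbitI: "g \<in> lie_aut0 br \<Longrightarrow> g H \<in> adjoint_orbit br H"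
  by (auto simp: adjoint_orbit_def)

locale cartan_orbit = cartan_subgroup + cartan_element
begin

text \<open>This is \<open>K (H + \<nn>)\<close> with the group element moved to the other side; a
  compact group carries a closed set to a closed set, by passing to a convergent subsequence of the
  group elements.\<close>

lemma closed_orbit_model: "closed {z. \<exists>k\<in>K. k z - H \<in> \<nn>}"
proof (unfold closed_sequential_limits, intro allI impI, elim conjE)
  fix z :: "nat \<Rightarrow> 'a" and l
  assume z: "\<forall>n. z n \<in> {z. \<exists>k\<in>K. k z - H \<in> \<nn>}" and lim: "z \<longlonglongrightarrow> l"
  then obtain k where k: "\<And>n. k n \<in> K" "\<And>n. k n (z n) - H \<in> \<nn>"
    by simp metis
  then obtain g \<phi> where g: "g \<in> K" "strict_mono \<phi>" "(k \<circ> \<phi>) \<longlonglongrightarrow> g"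
    using compact_K unfolding compact_def by metis
  have "(\<lambda>n. k (\<phi> n) (z (\<phi> n)) - H) \<longlonglongrightarrow> g l - H"
    using g(3) LIMSEQ_subseq_LIMSEQ[OF lim g(2)]
    by (intro tendsto_intros) (simp_all add: comp_def)
  then have "g l - H \<in> \<nn>"
    by (rule closed_sequentially[OF closed_subspace[OF subspace_n], rotated]) (rule k)
  then show "l \<in> {z. \<exists>k\<in>K. k z - H \<in> \<nn>}" using g(1) by blast
qed

text \<open>Openness of the condition \<open>g H \<in> K (H + \<nn>)\<close>: near the identity every automorphism
  factors as \<open>exp (ad U) \<circ> exp (ad P)\<close> with \<open>\<theta> U = U\<close> and \<open>P \<in> \<pp>\<close>, and the second factor
  preserves \<open>H + \<nn>\<close>.\<close>

lemma orbit_subset: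
  assumes "g \<in> lie_aut0 br"
  shows "\<exists>k\<in>K. k (g H) - H \<in> \<nn>"
proof -
  define S where "S = {z. \<exists>k\<in>K. blinfun_apply k z - H \<in> \<nn>}"
  define R where "R = {g \<in> lie_aut0 br. blinfun_apply g H \<in> S}"
  obtain \<kappa> where \<kappa>: "linear \<kappa>" "\<And>X. \<theta> (\<kappa> X) = \<kappa> X" "\<And>X. X - \<kappa> X \<in> \<pp>"
    using linear_projection_fixed by blast
  obtain \<epsilon> where \<epsilon>: "\<epsilon> > 0" "\<And>g. g \<in> lie_aut br \<Longrightarrow> norm (g - id_blinfun) < \<epsilon> \<Longrightarrow>
    \<exists>X. norm X \<le> 1 \<and> g = blinfun_exp (ad br (\<kappa> X)) o\<^sub>L blinfun_exp (ad br (X - \<kappa> X))"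
    using lie_aut_chart[OF \<kappa>(1), of 1] by auto
  have "openin (top_of_set (lie_aut0 br)) R"
  proof (subst openin_subopen, intro ballI)
    fix g assume g: "g \<in> R"
    then obtain k where k: "k \<in> K" "k (g H) - H \<in> \<nn>" by (auto simp: R_def S_def)
    obtain k' where k': "k' \<in> K" "k o\<^sub>L k' = id_blinfun" "\<And>X. k' (blinfun_apply k X) = X"
      using K_inverse[OF k(1)] by metis
    have "g \<in> lie_aut br" using g lie_aut0_subset by (auto simp: R_def)
    then obtain g' where g': "g' \<in> lie_aut br" "g o\<^sub>L g' = id_blinfun"
      "\<And>X. g' (blinfun_apply g X) = X"
      using lie_aut_inverse by metis
    \<comment> \<open>Normalized so that \<open>g\<close> goes to the identity and
      \<open>F f\<close> takes \<open>k (g H)\<close>, a point of \<open>H + \<nn>\<close>, to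
      \<open>k (f H)\<close>.\<close>
    define F where "F f = k o\<^sub>L f o\<^sub>L g' o\<^sub>L k'" for f
    have "continuous_on UNIV F"
      unfolding F_def by (intro continuous_intros)
    then have "open (F -` ball id_blinfun \<epsilon>)"
      by (simp add: continuous_on_open_vimage)
    then have "openin (top_of_set (lie_aut0 br)) (lie_aut0 br \<inter> F -` ball id_blinfun \<epsilon>)"
      by (rule openin_open_Int)
    moreover have "F g = id_blinfun"
    proof (rule blinfun_eqI)
      fix X
      have "g (g' Y) = Y" "k (k' Y) = Y" for Y
        using arg_cong[OF g'(2), of "\<lambda>f. blinfun_apply f Y"]
          arg_cong[OF k'(2), of "\<lambda>f. blinfun_apply f Y"] by simp_all
      then show "F g X = id_blinfun X" by (simp add: F_def)
    qed
    then have "g \<in> lie_aut0 br \<inter> F -` ball id_blinfun \<epsilon>"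
      using g \<epsilon>(1) by (simp add: R_def)
    moreover have "lie_aut0 br \<inter> F -` ball id_blinfun \<epsilon> \<subseteq> R"
    proof
      fix f assume f: "f \<in> lie_aut0 br \<inter> F -` ball id_blinfun \<epsilon>"
      then have "F f \<in> lie_aut br"
        using K_lie_aut[OF k(1)] K_lie_aut[OF k'(1)] g'(1) lie_aut0_subset
        unfolding F_def by (intro compose_mem_lie_aut) auto
      moreover have "norm (F f - id_blinfun) < \<epsilon>"
        using f by (simp add: dist_norm norm_minus_commute)
      ultimately obtain X where
        X: "F f = blinfun_exp (ad br (\<kappa> X)) o\<^sub>L blinfun_exp (ad br (X - \<kappa> X))"
        using \<epsilon>(2) by blast
      define y where "y = blinfun_exp (ad br (X - \<kappa> X)) (k (g H))"
      have y: "y - H \<in> \<nn>"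
        unfolding y_def by (rule blinfun_exp_p[OF \<kappa>(3) k(2)])
      have "k (f H) = F f (k (g H))"
        by (simp add: F_def k' g')
      then have "k (f H) = blinfun_exp (ad br (\<kappa> X)) y" by (simp add: X y_def)
      then have "blinfun_exp (- ad br (\<kappa> X)) (k (f H)) = y"
        by (simp add: blinfun_exp_apply_inverse)
      moreover have "- ad br (\<kappa> X) = ad br (- \<kappa> X)" by (simp add: linear_neg[OF linear_ad])
      \<comment> \<open>The factor with fixed generator is absorbed into \<open>k\<close>.\<close>
      ultimately have "(blinfun_exp (ad br (- \<kappa> X)) o\<^sub>L k) (f H) - H \<in> \<nn>"
        using y by simp
      moreover have "blinfun_exp (ad br (- \<kappa> X)) o\<^sub>L k \<in> K"
        using k(1) by (intro K_compose blinfun_exp_mem_K) (simp_all add: linear_neg[OF linear_theta] \<kappa>(2))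
      ultimately show "f \<in> R" using f unfolding R_def S_def by blast
    qed
    ultimately show "\<exists>T. openin (top_of_set (lie_aut0 br)) T \<and> g \<in> T \<and> T \<subseteq> R" by blast
  qed
  moreover have "closedin (top_of_set (lie_aut0 br)) R"
  proof -
    have "closed ((\<lambda>g. blinfun_apply g H) -` S)"
      using closed_orbit_model unfolding S_def
      by (intro continuous_closed_vimage) (auto intro!: continuous_intros)
    then have "closedin (top_of_set (lie_aut0 br)) (lie_aut0 br \<inter> (\<lambda>g. blinfun_apply g H) -` S)"
      by (rule closedin_closed_Int)
    moreover have "R = lie_aut0 br \<inter> (\<lambda>g. blinfun_apply g H) -` S" by (auto simp: R_def)
    ultimately show ?thesis by simp
  qed
  moreover have "id_blinfun \<in> R"
    using id_mem_lie_aut0 K_id subspace_0[OF subspace_n]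
    by (auto simp: R_def S_def intro!: bexI[of _ id_blinfun])
  ultimately have "R = lie_aut0 br"
    using connected_lie_aut0 unfolding connected_clopen by blast
  then show ?thesis using assms by (auto simp: R_def S_def)
qed

lemma adjoint_orbit_eq: "adjoint_orbit br H = (\<Union>k\<in>K. {blinfun_apply k (H + Y) | Y. Y \<in> \<nn>})"
proof (intro equalityI subsetI)
  fix z assume "z \<in> adjoint_orbit br H"
  then obtain g where g: "g \<in> lie_aut0 br" "z = g H" by (auto simp: adjoint_orbit_def)
  then obtain k where k: "k \<in> K" "k z - H \<in> \<nn>" using orbit_subset by blast
  obtain k' where k': "k' \<in> K" "\<And>X. k' (blinfun_apply k X) = X"
    using K_inverse[OF k(1)] by metis
  have "z = k' (H + (k z - H))" by (simp add: k')
  then show "z \<in> (\<Union>k\<in>K. {blinfun_apply k (H + Y) | Y. Y \<in> \<nn>})" using k(2) k'(1) by blast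
next
  fix z assume "z \<in> (\<Union>k\<in>K. {blinfun_apply k (H + Y) | Y. Y \<in> \<nn>})"
  then obtain k Y where k: "k \<in> K" "Y \<in> \<nn>" "z = k (H + Y)" by blast
  obtain g where g: "g \<in> lie_aut0 br" "H + Y = g H" using H_plus_n_subset_orbit[OF k(2)] by blast
  have "z = (k o\<^sub>L g) H" by (simp add: k(3) g(2))
  then show "z \<in> adjoint_orbit br H"
    using adjoint_orbitI[OF compose_mem_lie_aut0[OF K_lie_aut0[OF k(1)] g(1)], of H] by simp
qed

end

section \<open>The deformed bracket\<close>

text \<open>Conjugation is continuous and fixes the identity, so it respects identity components.
  Exchanging \<open>T\<close> and \<open>T'\<close> gives the opposite direction.\<close>

lemma lie_aut0_conjugate_subset:
  fixes T T' :: "'a::euclidean_space \<Rightarrow>\<^sub>L 'a"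
  assumes T: "\<And>X. T (blinfun_apply T' X) = X" "\<And>X. T' (blinfun_apply T X) = X"
    and br': "\<And>X Y. br' X Y = T (br (T' X) (T' Y))"
    and g: "g \<in> lie_aut0 br"
  shows "T o\<^sub>L g o\<^sub>L T' \<in> lie_aut0 br'"
proof -
  let ?c = "\<lambda>g. T o\<^sub>L g o\<^sub>L T'"
  have id: "id_blinfun \<in> lie_aut br"
    using bij_id by (auto simp: lie_aut_def id_def)
  have "blinfun_apply T \<circ> blinfun_apply T' = id" "blinfun_apply T' \<circ> blinfun_apply T = id"
    using T by auto
  then have bij: "bij (blinfun_apply T)" "bij (blinfun_apply T')"
    using o_bij by blast+
  have "?c h \<in> lie_aut br'" if h: "h \<in> lie_aut br" for h
  proof -
    have "bij (blinfun_apply T \<circ> blinfun_apply h \<circ> blinfun_apply T')"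
      using h bij by (intro bij_comp) (auto simp: lie_aut_def)
    moreover have "blinfun_apply (?c h) = blinfun_apply T \<circ> blinfun_apply h \<circ> blinfun_apply T'"
      by auto
    ultimately show ?thesis
      using h by (auto simp: lie_aut_def br' T)
  qed
  then have "?c ` lie_aut0 br \<subseteq> lie_aut br'"
    using connected_component_subset[of "lie_aut br"] by (auto simp: lie_aut0_def)
  moreover have "connected (?c ` lie_aut0 br)"
    by (intro connected_continuous_image continuous_intros) (simp add: lie_aut0_def)
  moreover have "id_blinfun \<in> ?c ` lie_aut0 br"
    using id by (intro image_eqI[of _ _ id_blinfun])
      (auto intro!: blinfun_eqI simp: T lie_aut0_def connected_component_refl)
  ultimately have "?c ` lie_aut0 br \<subseteq> lie_aut0 br'"
    unfolding lie_aut0_def by (intro connected_component_maximal)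
  then show ?thesis using g by blast
qed

lemma adjoint_orbit_conjugate:
  fixes T T' :: "'a::euclidean_space \<Rightarrow>\<^sub>L 'a"
  assumes T: "\<And>X. T (blinfun_apply T' X) = X" "\<And>X. T' (blinfun_apply T X) = X"
    and br': "\<And>X Y. br' X Y = T (br (T' X) (T' Y))"
  shows "adjoint_orbit br' (T H) = blinfun_apply T ` adjoint_orbit br H"
proof (intro equalityI subsetI)
  fix z assume "z \<in> adjoint_orbit br' (T H)"
  then obtain g where g: "g \<in> lie_aut0 br'" "z = g (T H)" by (auto simp: adjoint_orbit_def)
  have "T' o\<^sub>L g o\<^sub>L T \<in> lie_aut0 br"
    by (rule lie_aut0_conjugate_subset[OF T(2,1) _ g(1)]) (simp add: br' T)
  moreover have "z = T ((T' o\<^sub>L g o\<^sub>L T) H)" by (simp add: g T)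
  ultimately show "z \<in> blinfun_apply T ` adjoint_orbit br H"
    using adjoint_orbitI by blast
next
  fix z assume "z \<in> blinfun_apply T ` adjoint_orbit br H"
  then obtain g where g: "g \<in> lie_aut0 br" "z = T (g H)" by (auto simp: adjoint_orbit_def)
  have "T o\<^sub>L g o\<^sub>L T' \<in> lie_aut0 br'"
    by (rule lie_aut0_conjugate_subset[OF T br' g(1)])
  moreover have "z = (T o\<^sub>L g o\<^sub>L T') (T H)" by (simp add: g T)
  ultimately show "z \<in> adjoint_orbit br' (T H)"
    using adjoint_orbitI by metis
qed

section \<open>The deformation map and its relation to \<open>psi\<close>\<close>

lemma T_map_inverse:
  assumes "linear \<theta>" "\<And>X. \<theta> (\<theta> X) = X" "r \<noteq> 0"
  shows "T_map \<theta> r (T_map \<theta> (1 / r) Z) = Z"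
proof -
  let ?U = "(1/2) *\<^sub>R (Z + \<theta> Z)" and ?V = "(1/2) *\<^sub>R (Z - \<theta> Z)"
  have U: "\<theta> ?U = ?U" and V: "\<theta> ?V = - ?V"
    using assms(1,2) by (simp_all add: linear_add linear_diff linear_scale algebra_simps)
  have lin: "linear (T_map \<theta> r)" by (rule linear_T_map[OF assms(1)])
  have "T_map \<theta> r (T_map \<theta> (1 / r) Z) = T_map \<theta> r ((1 / r) *\<^sub>R ?U + ?V)"
    by (simp only: T_map_def)
  also have "\<dots> = (1 / r) *\<^sub>R T_map \<theta> r ?U + T_map \<theta> r ?V"
    by (simp only: linear_add[OF lin] linear_scale[OF lin])
  also have "\<dots> = ?U + ?V"
    unfolding T_map_fixed[where \<theta>=\<theta> and X="?U", OF U] T_map_antifixed[where \<theta>=\<theta> and Y="?V", OF V] using assms(3) by simp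
  also have "\<dots> = Z" by (simp add: algebra_simps flip: scaleR_left.add)
  finally show ?thesis .
qed

text \<open>The coefficients of \<open>Z\<close> and \<open>\<theta> Z\<close> are
  \<open>(r + 1) / 2\<close> and \<open>(r - 1) / 2\<close>; their quotient is the coefficient in
  \<open>psi\<close>.\<close>

lemma T_map_eq_psi:
  assumes "r + 1 \<noteq> 0" "linear \<theta>"
  shows "T_map \<theta> r Z = psi \<theta> r (((r + 1) / 2) *\<^sub>R Z)"
proof -
  have "T_map \<theta> r Z = ((r + 1) / 2) *\<^sub>R Z + ((r - 1) / 2) *\<^sub>R \<theta> Z"
    by (simp add: T_map_def algebra_simps add_divide_distrib diff_divide_distrib)
  moreover have "(r - 1) / (r + 1) * ((r + 1) / 2) = (r - 1) / 2" using assms(1) by simp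
  ultimately show ?thesis using assms(2) by (simp add: psi_def linear_scale)
qed

theorem proposition8:
  fixes br :: "'a::euclidean_space \<Rightarrow> 'a \<Rightarrow> 'a"
    and \<theta> :: "'a \<Rightarrow> 'a"
    and \<kk> \<ss> \<aa> \<aa>p :: "'a set"
    and K :: "('a \<Rightarrow>\<^sub>L 'a) set"
    and r :: real and H :: 'a
  assumes "lie_bracket br"
    and "semisimple br"
    and "noncompact br"
    and "cartan_decomposition br \<theta> \<kk> \<ss>"
    and "maximal_abelian_in br \<ss> \<aa>"
    and "weyl_chamber br \<aa> \<aa>p"
    and "connected_subgroup_with_lie_algebra br \<kk> K"
    and "r > 0"
    and "H \<in> closure \<aa>p"
  shows "adjoint_orbit (deformed_bracket br \<theta> r) H =
    (\<Union>k\<in>K. {blinfun_apply k H + Z | Z. Z \<in> psi \<theta> r ` (blinfun_apply k ` n_plus br \<aa> H)})"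
proof -
  have \<theta>: "cartan_involution br \<theta>" and kk: "\<kk> = {X. \<theta> X = X}" and ss: "\<ss> = {X. \<theta> X = - X}"
    using assms(4) by (auto simp: cartan_decomposition_def)
  have aa: "abelian_subspace br \<aa>" "\<aa> \<subseteq> \<ss>"
    using assms(5) by (auto simp: maximal_abelian_in_def)
  have "\<aa>p \<subseteq> \<aa>"
    using assms(6) in_components_subset by (fastforce simp: weyl_chamber_def)
  moreover have "closed \<aa>"
    using aa(1) by (simp add: abelian_subspace_def closed_subspace)
  ultimately have Ha: "H \<in> \<aa>" using assms(9) closure_minimal by blast
  interpret cartan_orbit br \<theta> K \<aa> H
    using assms(1,7) \<theta> aa Ha by unfold_locales (auto simp: kk ss)
  define T where "T = Blinfun (T_map \<theta> r)"
  define T' where "T' = Blinfun (T_map \<theta> (1 / r))"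
  have T: "blinfun_apply T = T_map \<theta> r" and T': "blinfun_apply T' = T_map \<theta> (1 / r)"
    using linear_T_map[OF linear_theta]
    by (simp_all add: T_def T'_def bounded_linear_Blinfun_apply linear_conv_bounded_linear)
  have TT': "T (T' X) = X" "T' (T X) = X" for X
    using T_map_inverse[OF linear_theta theta_theta, of r]
      T_map_inverse[OF linear_theta theta_theta, of "1 / r"] assms(8) by (simp_all add: T T')
  have inv: "inv (T_map \<theta> r) = blinfun_apply T'"
    using TT' by (intro inv_unique_comp) (auto simp: T[symmetric])
  have "T H = H"
    using T_map_antifixed antifixed[OF Ha] by (simp add: T)
  moreover have "adjoint_orbit (deformed_bracket br \<theta> r) (T H) = blinfun_apply T ` adjoint_orbit br H"
    by (rule adjoint_orbit_conjugate[OF TT']) (simp add: deformed_bracket_def inv T)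
  ultimately have "adjoint_orbit (deformed_bracket br \<theta> r) H
      = blinfun_apply T ` (\<Union>k\<in>K. {blinfun_apply k (H + Y) | Y. Y \<in> n_plus br \<aa> H})"
    by (simp add: adjoint_orbit_eq)
  also have "\<dots> = (\<Union>k\<in>K. {blinfun_apply k H + T (k Y) | Y. Y \<in> n_plus br \<aa> H})"
  proof -
    have "T (k (H + Y)) = k H + T (k Y)" if "k \<in> K" for k Y
    proof -
      \<comment> \<open>\<open>k H\<close> stays in the \<open>-1\<close>-eigenspace, so the
        deformation leaves it alone and acts only on the \<open>\<nn>\<close>-part.\<close>
      have "\<theta> (k H) = - k H"
        using K_theta[OF that, of H] antifixed[OF Ha] by (simp add: blinfun.minus_right)
      then show ?thesis by (simp add: blinfun.add_right T T_map_antifixed linear_add[OF linear_T_map[OF linear_theta]])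
    qed
    then show ?thesis by (simp add: Setcompr_eq_image image_UN image_image)
  qed
  also have "\<dots> = (\<Union>k\<in>K. {blinfun_apply k H + Z | Z. Z \<in> psi \<theta> r ` (blinfun_apply k ` n_plus br \<aa> H)})"
  proof -
    have "blinfun_apply T ` (blinfun_apply k ` n_plus br \<aa> H) = psi \<theta> r ` (blinfun_apply k ` n_plus br \<aa> H)" for k
    proof -
      have psi: "T (k Y) = psi \<theta> r (k (((r + 1) / 2) *\<^sub>R Y))" for Y
        using assms(8) T_map_eq_psi[of r \<theta> "k Y"] linear_theta by (simp add: T blinfun.scaleR_right)
      have r: "(r + 1) / 2 * (2 / (r + 1)) = 1" using assms(8) by simp
      \<comment> \<open>The factor between the two maps is a nonzero scalar and is absorbed by the
        subspace \<open>\<nn>\<close>.\<close>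
      have "psi \<theta> r (k Y) = T (k ((2 / (r + 1)) *\<^sub>R Y))" for Y
        by (simp only: psi scaleR_scaleR r scaleR_one)
      then show ?thesis
        unfolding image_image using psi subspace_scale[OF subspace_n]
        by (intro equalityI image_subsetI) blast+
    qed
    then show ?thesis by (fastforce simp: image_iff set_eq_iff)
  qed
  finally show ?thesis .
qed

end
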